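(* Let $\mathcal{X}$ be a finite non-empty set and let $\overline{T}\colon\mathbb{R}^{\mathcal{X}}\to\mathbb{R}^{\mathcal{X}}$ be an upper transition operator. Let $d\in\mathbb{N}$, the sets $\mathcal{X}_{\mathrm{t}\triangledown}^{0},\dots,\mathcal{X}_{\mathrm{t}\triangledown}^{d}$ and, for $\ell\in\{1,\dots,d\}$, the maximal communication classes $\mathcal{X}_{\mathrm{m},1}^{\ell},\dots,\mathcal{X}_{\mathrm{m},M_\ell}^{\ell}$ of the restricted operator $\overline{T}_{\mathcal{X}_{\mathrm{t}\triangledown}^{\ell-1}}$ be as in the repeated decomposition of $\mathcal{X}$ described in the context. If for all $\ell\in\{1,\dots,d\}$ the classes $\mathcal{X}_{\mathrm{m},1}^{\ell},\dots,\mathcal{X}_{\mathrm{m},M_\ell}^{\ell}$ are all regular for $\overline{T}_{\mathcal{X}_{\mathrm{t}\triangledown}^{\ell-1}}$, then $\overline{T}$ is convergent, i.e. for every $f\in\mathbb{R}^{\mathcal{X}}$ the sequence $(\overline{T}^n f)_{n\in\mathbb{N}}$ converges.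
   Context: The following definitions apply to any finite non-empty state space $\mathcal{Y}$ (in particular to $\mathcal{X}$ and its non-empty subsets). $\mathbb{N}=\{1,2,\dots\}$; order on functions is pointwise; constants are identified with constant functions; $\mathbb{1}_A$ is the indicator of $A$ and $\mathbb{1}_y=\mathbb{1}_{\{y\}}$. Upper transition operator on $\mathcal{Y}$: a map $\overline{T}\colon\mathbb{R}^{\mathcal{Y}}\to\mathbb{R}^{\mathcal{Y}}$ with $\overline{T}(f+g)\le\overline{T}f+\overline{T}g$, $\overline{T}(\lambda f)=\lambda\overline{T}f$ for real $\lambda\ge0$, and $\overline{T}f\le\max f$. Its conjugate lower transition operator is $\underline{T}f:=-\overline{T}(-f)$. $\overline{T}$ is convergent if $(\overline{T}^nf)_{n\in\mathbb{N}}$ converges for all $f\in\mathbb{R}^{\mathcal{Y}}$. Graph notions: the upper accessibility graph of $\overline{T}$ has node set $\mathcal{Y}$ and a directed edge from $x$ to $y$ iff $\overline{T}\mathbb{1}_y(x)>0$. $y$ is accessible from $x$ if $y=x$ or there is a directed path from $x$ to $y$. Two states communicate if each is accessible from the other; the equivalence classes are the communication classes. A communication class is maximal if no state outside it is accessible from a state in it. A maximal communication class $C$ is regular (for $\overline{T}$) if the greatest common divisor of the lengths of the closed directed paths staying in $C$ is $1$; equivalently, if there is $N\in\mathbb{N}$ with $\overline{T}^n\mathbb{1}_y(x)>0$ for all $n\ge N$ and $x,y\in C$. A non-empty set $C\subseteq\mathcal{Y}$ is lower reachable from $x$ if $\underline{T}^n\mathbb{1}_C(x)>0$ for some $n\in\mathbb{N}$.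 Restriction: for $x\in\mathcal{Y}$, the credal set $\mathcal{Q}^x$ is the set of probability mass functions $p$ on $\mathcal{Y}$ with $\sum_y p(y)f(y)\le\overline{T}f(x)$ for all $f\in\mathbb{R}^{\mathcal{Y}}$. For non-empty $C\subseteq\mathcal{Y}$ and $x\in C$, $\mathcal{Q}^x_C:=\{p|_C\colon p\in\mathcal{Q}^x,\ p(y)=0\text{ for all }y\in\mathcal{Y}\setminus C\}$. If $\mathcal{Q}_C^x\neq\emptyset$ for all $x\in C$, the restricted operator $\overline{T}_C\colon\mathbb{R}^C\to\mathbb{R}^C$ is well defined: $\overline{T}_Cg(x):=\max\{\sum_{y\in C}q(y)g(y)\colon q\in\mathcal{Q}^x_C\}$; it is an upper transition operator on $C$. Repeated decomposition: set $\mathcal{X}_{\mathrm{t}\triangledown}^0:=\mathcal{X}$ and $\overline{T}_{\mathcal{X}_{\mathrm{t}\triangledown}^0}:=\overline{T}$. For $\ell=1,2,\dots$, as long as $\mathcal{X}_{\mathrm{t}\triangledown}^{\ell-1}\neq\emptyset$: let $\mathcal{X}_{\mathrm{m},1}^\ell,\dots,\mathcal{X}_{\mathrm{m},M_\ell}^\ell$ be the maximal communication classes of the upper transition operator $\overline{T}_{\mathcal{X}_{\mathrm{t}\triangledown}^{\ell-1}}$ on state space $\mathcal{X}_{\mathrm{t}\triangledown}^{\ell-1}$, let $\mathcal{X}_{\mathrm{m}}^\ell$ be their union, let $\mathcal{X}_{\mathrm{t}\blacktriangledown}^\ell$ (respectively $\mathcal{X}_{\mathrm{t}\triangledown}^\ell$)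 be the set of states in $\mathcal{X}_{\mathrm{t}\triangledown}^{\ell-1}\setminus\mathcal{X}_{\mathrm{m}}^\ell$ from which $\mathcal{X}_{\mathrm{m}}^\ell$ is (respectively is not) lower reachable with respect to $\overline{T}_{\mathcal{X}_{\mathrm{t}\triangledown}^{\ell-1}}$; if $\mathcal{X}_{\mathrm{t}\triangledown}^\ell\ne\emptyset$, restrict $\overline{T}_{\mathcal{X}_{\mathrm{t}\triangledown}^{\ell-1}}$ to $\mathcal{X}_{\mathrm{t}\triangledown}^\ell$ (this restriction is always well defined and equals $\overline{T}_{\mathcal{X}_{\mathrm{t}\triangledown}^{\ell}}$, the direct restriction of $\overline{T}$) and continue. $d$ is the first $\ell\ge1$ with $\mathcal{X}_{\mathrm{t}\triangledown}^\ell=\emptyset$. *)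

theory Defs
  imports "HOL-Analysis.Analysis"
begin

text \<open>
  A state space is a finite set \<open>Y :: 'a set\<close>, so that an operator and its restrictions to
  subsets can live over one type. The space of real functions on \<open>Y\<close> is \<open>Y \<rightarrow>\<^sub>E UNIV\<close>: functions
  that are \<open>undefined\<close> outside \<open>Y\<close>. The values of an operator at arguments outside this space
  are irrelevant.
\<close>

type_synonym 'a operator = "('a \<Rightarrow> real) \<Rightarrow> ('a \<Rightarrow> real)"

abbreviation fun_space :: "'a set \<Rightarrow> ('a \<Rightarrow> real) set" where
  "fun_space Y \<equiv> Y \<rightarrow>\<^sub>E (UNIV :: real set)"

definition ind :: "'a set \<Rightarrow> 'a set \<Rightarrow> 'a \<Rightarrow> real" where
  "ind Y A = (\<lambda>y\<in>Y. indicator A y)"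

definition upper_transition_operator :: "'a set \<Rightarrow> 'a operator \<Rightarrow> bool" where
  "upper_transition_operator Y T \<longleftrightarrow>
     T \<in> fun_space Y \<rightarrow> fun_space Y \<and>
     (\<forall>f\<in>fun_space Y. \<forall>g\<in>fun_space Y. \<forall>x\<in>Y. T (\<lambda>y\<in>Y. f y + g y) x \<le> T f x + T g x) \<and>
     (\<forall>c\<ge>0. \<forall>f\<in>fun_space Y. \<forall>x\<in>Y. T (\<lambda>y\<in>Y. c * f y) x = c * T f x) \<and>
     (\<forall>f\<in>fun_space Y. \<forall>x\<in>Y. T f x \<le> Max (f ` Y))"

definition lower_conjugate :: "'a set \<Rightarrow> 'a operator \<Rightarrow> 'a operator" where
  "lower_conjugate Y T f = (\<lambda>x\<in>Y. - T (\<lambda>y\<in>Y. - f y) x)"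

text \<open>On a finite state space, convergence of functions is pointwise convergence.\<close>

definition convergent_operator :: "'a set \<Rightarrow> 'a operator \<Rightarrow> bool" where
  "convergent_operator Y T \<longleftrightarrow>
     (\<forall>f\<in>fun_space Y. \<forall>x\<in>Y. convergent (\<lambda>n. (T ^^ n) f x))"

definition upper_graph :: "'a set \<Rightarrow> 'a operator \<Rightarrow> 'a rel" where
  "upper_graph Y T = {(x, y). x \<in> Y \<and> y \<in> Y \<and> T (ind Y {y}) x > 0}"

definition accessible :: "'a set \<Rightarrow> 'a operator \<Rightarrow> 'a \<Rightarrow> 'a \<Rightarrow> bool" where
  "accessible Y T x y \<longleftrightarrow> (x, y) \<in> (upper_graph Y T)\<^sup>*"

definition communication :: "'a set \<Rightarrow> 'a operator \<Rightarrow> 'a rel" where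
  "communication Y T =
     {(x, y). x \<in> Y \<and> y \<in> Y \<and> accessible Y T x y \<and> accessible Y T y x}"

definition communication_classes :: "'a set \<Rightarrow> 'a operator \<Rightarrow> 'a set set" where
  "communication_classes Y T = Y // communication Y T"

definition maximal_classes :: "'a set \<Rightarrow> 'a operator \<Rightarrow> 'a set set" where
  "maximal_classes Y T =
     {C \<in> communication_classes Y T. \<forall>x\<in>C. \<forall>y\<in>Y - C. \<not> accessible Y T x y}"

text \<open>\<open>(x, x) \<in> (upper_graph Y T \<inter> C \<times> C) ^^ n\<close> says that there is a closed directed path of
  length \<open>n\<close> through \<open>x\<close> that stays in \<open>C\<close>.\<close>

definition regular_class :: "'a set \<Rightarrow> 'a operator \<Rightarrow> 'a set \<Rightarrow> bool" where
  "regular_class Y T C \<longleftrightarrow>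
     Gcd {n. n \<ge> 1 \<and> (\<exists>x\<in>C. (x, x) \<in> (upper_graph Y T \<inter> C \<times> C) ^^ n)} = 1"

definition lower_reachable :: "'a set \<Rightarrow> 'a operator \<Rightarrow> 'a set \<Rightarrow> 'a \<Rightarrow> bool" where
  "lower_reachable Y T C x \<longleftrightarrow> (\<exists>n\<ge>1. (lower_conjugate Y T ^^ n) (ind Y C) x > 0)"

definition mass_functions :: "'a set \<Rightarrow> ('a \<Rightarrow> real) set" where
  "mass_functions Y = {p \<in> fun_space Y. (\<forall>y\<in>Y. p y \<ge> 0) \<and> (\<Sum>y\<in>Y. p y) = 1}"

definition credal_set :: "'a set \<Rightarrow> 'a operator \<Rightarrow> 'a \<Rightarrow> ('a \<Rightarrow> real) set" where
  "credal_set Y T x =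
     {p \<in> mass_functions Y. \<forall>f\<in>fun_space Y. (\<Sum>y\<in>Y. p y * f y) \<le> T f x}"

definition restricted_credal_set ::
  "'a set \<Rightarrow> 'a operator \<Rightarrow> 'a set \<Rightarrow> 'a \<Rightarrow> ('a \<Rightarrow> real) set" where
  "restricted_credal_set Y T C x =
     (\<lambda>p. restrict p C) ` {p \<in> credal_set Y T x. \<forall>y\<in>Y - C. p y = 0}"

text \<open>The supremum below is a maximum whenever the restricted credal set is non-empty; see
  \<open>restricted_operator_max\<close>.\<close>

definition restricted_operator :: "'a set \<Rightarrow> 'a operator \<Rightarrow> 'a set \<Rightarrow> 'a operator" where
  "restricted_operator Y T C g =
     (\<lambda>x\<in>C. SUP q\<in>restricted_credal_set Y T C x. \<Sum>y\<in>C. q y * g y)"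

lemma restricted_operator_max:
  assumes "finite Y" "C \<subseteq> Y" "x \<in> C" "restricted_credal_set Y T C x \<noteq> {}"
  shows "\<exists>q\<in>restricted_credal_set Y T C x.
           restricted_operator Y T C g x = (\<Sum>y\<in>C. q y * g y) \<and>
           (\<forall>r\<in>restricted_credal_set Y T C x. (\<Sum>y\<in>C. r y * g y) \<le> (\<Sum>y\<in>C. q y * g y))"
proof -
  let ?E = "\<lambda>p. \<Sum>y\<in>C. p y * g y"
  define P where "P = {p \<in> credal_set Y T x. \<forall>y\<in>Y - C. p y = 0}"
  define K where "K = Pi UNIV (\<lambda>i. if i \<in> Y then {0..1} else {undefined :: real})"
  have K_eq: "K = Y \<rightarrow>\<^sub>E {0..1}"
    by (auto simp: K_def PiE_def Pi_def extensional_def split: if_splits)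
  have "compact K"
  proof -
    have "compactin (product_topology (\<lambda>_. euclidean) UNIV)
            (PiE UNIV (\<lambda>i. if i \<in> Y then {0..1} else {undefined :: real}))"
      by (subst compactin_PiE) (auto simp: compactin_euclidean_iff)
    then show ?thesis
      by (simp add: K_def PiE_UNIV_domain flip: compactin_euclidean_iff euclidean_product_topology)
  qed
  have coord: "continuous_on UNIV (\<lambda>p :: 'a \<Rightarrow> real. p y)" for y
    by (rule continuous_on_product_coordinates)
  have "P = K \<inter> ({p. (\<Sum>y\<in>Y. p y) = 1} \<inter>
               (\<Inter>f\<in>fun_space Y. {p. (\<Sum>y\<in>Y. p y * f y) \<le> T f x}) \<inter>
               (\<Inter>y\<in>Y - C. {p. p y = 0}))" (is "_ = K \<inter> ?F")
  proof -
    have "p \<in> K \<longleftrightarrow> p \<in> fun_space Y \<and> (\<forall>y\<in>Y. p y \<ge> 0)" if "(\<Sum>y\<in>Y. p y) = 1" for p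
    proof -
      have "p y \<le> 1" if "y \<in> Y" "\<forall>y\<in>Y. p y \<ge> 0" for y
        using member_le_sum[of y Y p] that \<open>(\<Sum>y\<in>Y. p y) = 1\<close> assms(1) by auto
      then show ?thesis
        unfolding K_eq by (auto simp: PiE_def Pi_def)
    qed
    then show ?thesis
      unfolding P_def credal_set_def mass_functions_def by blast
  qed
  moreover have "closed ?F"
    by (intro closed_Int closed_INT ballI closed_Collect_eq closed_Collect_le
        continuous_on_sum continuous_on_mult continuous_on_const coord)
  ultimately have "compact P"
    using \<open>compact K\<close> by (simp add: compact_Int_closed)
  have Q: "restricted_credal_set Y T C x = (\<lambda>p. restrict p C) ` P"
    by (simp add: restricted_credal_set_def P_def)
  have E: "?E (restrict p C) = ?E p" for p
    by (rule sum.cong) auto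
  have "continuous_on P ?E"
    by (intro continuous_on_sum continuous_on_mult continuous_on_const
        continuous_on_subset[OF coord]) auto
  moreover have "P \<noteq> {}"
    using assms(4) Q by auto
  ultimately obtain p where p: "p \<in> P" "\<And>r. r \<in> P \<Longrightarrow> ?E r \<le> ?E p"
    using continuous_attains_sup[OF \<open>compact P\<close>] by blast
  have max: "?E r \<le> ?E (restrict p C)" if "r \<in> restricted_credal_set Y T C x" for r
    using that p unfolding Q by (auto simp: E simp del: restrict_apply)
  have mem: "restrict p C \<in> restricted_credal_set Y T C x"
    using p(1) Q by auto
  have "(SUP q\<in>restricted_credal_set Y T C x. ?E q) = ?E (restrict p C)"
    by (rule cSup_eq_maximum) (use max mem in \<open>auto simp del: restrict_apply\<close>)
  then have "restricted_operator Y T C g x = ?E (restrict p C)"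
    unfolding restricted_operator_def by (subst restrict_apply'[OF assms(3)])
  then show ?thesis
    using max mem by blast
qed

definition maximal_part :: "'a set \<Rightarrow> 'a operator \<Rightarrow> 'a set" where
  "maximal_part Y T = \<Union> (maximal_classes Y T)"

definition residual_part :: "'a set \<Rightarrow> 'a operator \<Rightarrow> 'a set" where
  "residual_part Y T =
     {x \<in> Y - maximal_part Y T. \<not> lower_reachable Y T (maximal_part Y T) x}"

text \<open>Stage \<open>l\<close> of the repeated decomposition consists of the set of the remaining states and
  the operator restricted to it. Once this set is empty, it stays empty.\<close>

primrec decomposition :: "'a set \<Rightarrow> 'a operator \<Rightarrow> nat \<Rightarrow> 'a set \<times> 'a operator" where
  "decomposition X T 0 = (X, T)"
| "decomposition X T (Suc l) =
     (let (Y, S) = decomposition X T l; Z = residual_part Y S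
      in (Z, restricted_operator Y S Z))"

definition residual_states :: "'a set \<Rightarrow> 'a operator \<Rightarrow> nat \<Rightarrow> 'a set" where
  "residual_states X T l = fst (decomposition X T l)"

definition residual_operator :: "'a set \<Rightarrow> 'a operator \<Rightarrow> nat \<Rightarrow> 'a operator" where
  "residual_operator X T l = snd (decomposition X T l)"

definition decomposition_depth :: "'a set \<Rightarrow> 'a operator \<Rightarrow> nat" where
  "decomposition_depth X T = (LEAST l. l \<ge> 1 \<and> residual_states X T l = {})"

lemma ex_maximal_class:
  assumes "finite Y" "Y \<noteq> {}"
  shows "\<exists>C\<in>maximal_classes Y T. C \<noteq> {} \<and> C \<subseteq> Y"
proof -
  let ?R = "\<lambda>x. {y \<in> Y. accessible Y T x y}"
  obtain x where x: "x \<in> Y" "\<And>y. y \<in> Y \<Longrightarrow> card (?R x) \<le> card (?R y)"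
    using ex_min_if_finite[of "(\<lambda>x. card (?R x)) ` Y"] assms by (fastforce simp: not_less)
  let ?C = "communication Y T `` {x}"
  have ret: "accessible Y T y x" if "y \<in> Y" "accessible Y T x y" for y
  proof -
    have "?R y \<subseteq> ?R x"
      using that unfolding accessible_def by auto
    then have "?R y = ?R x"
      using x(2)[OF that(1)] assms(1) by (intro card_seteq) auto
    then show ?thesis
      using x(1) by (auto simp: accessible_def)
  qed
  have C: "?C = ?R x"
    using x(1) ret by (auto simp: communication_def)
  have "?C \<in> communication_classes Y T"
    unfolding communication_classes_def using x(1) by (rule quotientI)
  then have "?C \<in> maximal_classes Y T"
    unfolding maximal_classes_def C by (auto simp: accessible_def)
  moreover have "x \<in> ?C"
    using x(1) by (auto simp: C accessible_def)
  ultimately show ?thesis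
    using C by blast
qed

lemma ex_decomposition_depth:
  assumes "finite X"
  shows "\<exists>l\<ge>1. residual_states X T l = {}"
proof -
  have step: "residual_states X T (Suc l) =
      residual_part (residual_states X T l) (residual_operator X T l)" for l
    by (simp add: residual_states_def residual_operator_def Let_def split: prod.splits)
  have "finite (residual_states X T l) \<and> card (residual_states X T l) \<le> card X - l" for l
  proof (induction l)
    case 0
    then show ?case using assms by (simp add: residual_states_def)
  next
    case (Suc l)
    let ?Y = "residual_states X T l"
    show ?case
    proof (cases "?Y = {}")
      case True
      then show ?thesis by (simp add: step residual_part_def)
    next
      case False
      then have "residual_states X T (Suc l) \<subset> ?Y"
        using ex_maximal_class[of ?Y "residual_operator X T l"] Suc
        unfolding step residual_part_def maximal_part_def by blast
      then have "finite (residual_states X T (Suc l))"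
        "card (residual_states X T (Suc l)) < card ?Y"
        using Suc psubset_card_mono by (auto intro: finite_subset)
      then show ?thesis using Suc by linarith
    qed
  qed
  from this[of "Suc (card X)"] show ?thesis
    by (intro exI[of _ "Suc (card X)"]) auto
qed

end

theory Submission
  imports Defs
begin

text \<open>
  The iterates \<open>T\<^sup>n f\<close> are bounded; let \<open>U\<close> and \<open>L\<close> be their pointwise upper and lower limits.
  By monotonicity \<open>U \<le> T U\<close> and \<open>T L \<le> L\<close>, so \<open>w = U - L\<close> satisfies \<open>w \<le> T w\<close> by subadditivity.
  If \<open>max w > 0\<close>, let \<open>A\<close> be the set where \<open>w\<close> is maximal. For \<open>x \<in> A\<close>, a mass function in the
  credal set of \<open>x\<close> that attains \<open>T w x\<close> must live on \<open>A\<close>. At every stage of the decomposition the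
  restricted operator is dominated by \<open>T\<close>, and on a regular maximal class its iterates lift all
  values for good above the smallest lower limit as soon as one value is above it. This forces
  \<open>U \<le> L\<close> there, so \<open>A\<close> avoids these classes; and since the process can be kept in \<open>A\<close>, they are
  not lower reachable from \<open>A\<close>. So \<open>A\<close> is contained in all residual sets, the last of which is
  empty.
\<close>

section \<open>Dominated linear functionals\<close>

text \<open>Positive homogeneity is stated as an inequality, the form that is checked for infima
  below; scaling back by the inverse factor yields equality in
  \<open>sublinear_scale\<close>.\<close>

definition sublinear :: "(('a \<Rightarrow> real) \<Rightarrow> real) \<Rightarrow> bool" where
  "sublinear P \<longleftrightarrow>
     (\<forall>f g. P (\<lambda>y. f y + g y) \<le> P f + P g) \<and> (\<forall>c\<ge>0. \<forall>f. P (\<lambda>y. c * f y) \<le> c * P f)"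

lemma sublinear_add: "sublinear P \<Longrightarrow> P (\<lambda>y. f y + g y) \<le> P f + P g"
  unfolding sublinear_def by blast

lemma sublinear_scale_le: "sublinear P \<Longrightarrow> c \<ge> 0 \<Longrightarrow> P (\<lambda>y. c * f y) \<le> c * P f"
  unfolding sublinear_def by blast

lemma sublinear_zero:
  assumes "sublinear P"
  shows "P (\<lambda>y. 0) = 0"
  using sublinear_scale_le[OF assms, of 0] sublinear_add[OF assms, of "\<lambda>y. 0" "\<lambda>y. 0"] by simp

lemma sublinear_scale:
  assumes "sublinear P" "c \<ge> 0"
  shows "P (\<lambda>y. c * f y) = c * P f"
proof (cases "c = 0")
  case True
  then show ?thesis using sublinear_zero[OF assms(1)] by simp
next
  case False
  have "P (\<lambda>y. (1 / c) * (c * f y)) \<le> (1 / c) * P (\<lambda>y. c * f y)"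
    using assms by (intro sublinear_scale_le) auto
  then have "c * P f \<le> P (\<lambda>y. c * f y)"
    using assms False by (simp add: field_simps)
  then show ?thesis
    using sublinear_scale_le[OF assms] by (intro antisym)
qed

lemma sublinear_minus:
  assumes "sublinear P"
  shows "- P (\<lambda>y. - f y) \<le> P f"
  using sublinear_add[OF assms, of f "\<lambda>y. - f y"] sublinear_zero[OF assms] by simp

text \<open>One Hahn-Banach step: \<open>P'\<close> sends f to the infimum of P(f + t g) - t P(g)
  over t \<ge> 0. It lies below \<open>P\<close>, and its bound at -g together with subadditivity
  makes it linear along g with P'(g) = P(g).\<close>

lemma sublinear_linear_along:
  assumes P: "sublinear P"
  shows "\<exists>P'. sublinear P' \<and> (\<forall>f. P' f \<le> P f) \<and> P' (\<lambda>y. - g y) \<le> - P g"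
proof -
  define V where "V f t = P (\<lambda>y. f y + t * g y) - t * P g" for f t
  define P' where "P' f = (INF t\<in>{0..}. V f t)" for f
  have bdd: "bdd_below (V f ` {0..})" for f
  proof (rule bdd_belowI2)
    fix t :: real assume "t \<in> {0..}"
    then have "P (\<lambda>y. t * g y) = t * P g"
      using sublinear_scale[OF P] by simp
    moreover have "P (\<lambda>y. (f y + t * g y) + - f y) \<le> P (\<lambda>y. f y + t * g y) + P (\<lambda>y. - f y)"
      by (rule sublinear_add[OF P])
    ultimately show "- P (\<lambda>y. - f y) \<le> V f t" by (simp add: V_def)
  qed
  have P'_le: "P' f \<le> V f t" if "t \<ge> 0" for f t
    unfolding P'_def using that by (intro cINF_lower bdd) auto
  have le_P': "b \<le> P' f" if "\<And>t. t \<ge> 0 \<Longrightarrow> b \<le> V f t" for b f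
    unfolding P'_def using that by (intro cINF_greatest) auto
  have V_add: "V (\<lambda>y. f y + h y) (s + t) \<le> V f s + V h t" for f h s t
    using sublinear_add[OF P, of "\<lambda>y. f y + s * g y" "\<lambda>y. h y + t * g y"]
    by (simp add: V_def algebra_simps)
  \<comment> \<open>Subadditivity follows from \<open>V_add\<close> by taking infima one variable at
    a time: over s with t fixed here, over t afterwards.\<close>
  have "P' (\<lambda>y. f y + h y) - P' f \<le> V h t" if "t \<ge> 0" for f h t
  proof -
    have "P' (\<lambda>y. f y + h y) - V h t \<le> P' f"
    proof (rule le_P')
      fix s :: real assume "s \<ge> 0"
      then show "P' (\<lambda>y. f y + h y) - V h t \<le> V f s"
        using P'_le[of "s + t" "\<lambda>y. f y + h y"] V_add[of f h s t] that by simp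
    qed
    then show ?thesis by simp
  qed
  then have "P' (\<lambda>y. f y + h y) - P' f \<le> P' h" for f h
    by (intro le_P')
  moreover have "P' (\<lambda>y. c * f y) \<le> c * P' f" if "c \<ge> 0" for c f
  proof (cases "c = 0")
    case True
    then show ?thesis
      using P'_le[of 0 "\<lambda>y. 0"] sublinear_zero[OF P] by (simp add: V_def)
  next
    case False
    have "P' (\<lambda>y. c * f y) / c \<le> P' f"
    proof (rule le_P')
      fix t :: real assume "t \<ge> 0"
      \<comment> \<open>Replacing the parameter t by c t lets the factor c be pulled out of the
        infimum.\<close>
      have "V (\<lambda>y. c * f y) (c * t) = c * V f t"
        using sublinear_scale[OF P that, of "\<lambda>y. f y + t * g y"]
        by (simp add: V_def algebra_simps)
      then show "P' (\<lambda>y. c * f y) / c \<le> V f t"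
        using P'_le[of "c * t" "\<lambda>y. c * f y"] that False \<open>t \<ge> 0\<close> by (simp add: field_simps)
    qed
    then show ?thesis using that False by (simp add: field_simps)
  qed
  ultimately have "sublinear P'"
    unfolding sublinear_def by (auto simp: algebra_simps)
  moreover have "P' f \<le> P f" for f
    using P'_le[of 0 f] by (simp add: V_def)
  \<comment> \<open>The parameter t = 1 cancels g and leaves P(0) - P(g).\<close>
  moreover have "P' (\<lambda>y. - g y) \<le> - P g"
    using P'_le[of 1 "\<lambda>y. - g y"] sublinear_zero[OF P] by (simp add: V_def)
  ultimately show ?thesis by blast
qed

text \<open>Linearity along earlier directions h survives every further step, because a smaller
  functional has a smaller value at -h and a larger negated value at h.\<close>

lemma sublinear_linear_along_finite:
  assumes "finite F" "sublinear P"
  shows "\<exists>P'. sublinear P' \<and> (\<forall>f. P' f \<le> P f) \<and> (\<forall>g\<in>F. P' (\<lambda>y. - g y) \<le> - P' g)"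
  using assms
proof (induction F)
  case empty
  then show ?case by blast
next
  case (insert g F)
  then obtain P1 where P1: "sublinear P1" "\<And>f. P1 f \<le> P f" "\<And>g. g \<in> F \<Longrightarrow> P1 (\<lambda>y. - g y) \<le> - P1 g"
    by blast
  obtain P2 where P2: "sublinear P2" "\<And>f. P2 f \<le> P1 f" "P2 (\<lambda>y. - g y) \<le> - P1 g"
    using sublinear_linear_along[OF P1(1)] by blast
  have "P2 f \<le> P f" for f
    using P1(2) P2(2) order_trans by blast
  moreover have "P2 (\<lambda>y. - h y) \<le> - P2 h" if "h \<in> insert g F" for h
    using that P1(3)[of h] P2(2)[of h] P2(2)[of "\<lambda>y. - h y"] P2(3) by auto
  ultimately show ?case using P2(1) by blast
qed

lemma sublinear_sum:
  assumes P: "sublinear P" and "finite A"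
  shows "P (\<lambda>z. \<Sum>y\<in>A. h y z) \<le> (\<Sum>y\<in>A. P (h y))"
  using assms(2)
proof (induction A)
  case empty
  then show ?case using sublinear_zero[OF P] by simp
next
  case (insert a A)
  then show ?case
    using sublinear_add[OF P, of "h a" "\<lambda>z. \<Sum>y\<in>A. h y z"] by simp
qed

text \<open>Finite-dimensional Hahn-Banach theorem: linearise first along w, which fixes the value
  there, then along all point indicators. The resulting functional is a weighted sum whose weights
  are its values at these indicators.\<close>

lemma sublinear_supporting_functional:
  assumes P: "sublinear P" and Y: "finite Y"
    and cong: "\<And>f g. (\<And>y. y \<in> Y \<Longrightarrow> f y = g y) \<Longrightarrow> P f = P g"
  shows "\<exists>p. (\<forall>f. (\<Sum>y\<in>Y. p y * f y) \<le> P f) \<and> (\<Sum>y\<in>Y. p y * w y) = P w"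
proof -
  define \<delta> where "\<delta> y = (indicator {y} :: 'a \<Rightarrow> real)" for y
  \<comment> \<open>\<open>r f\<close> extends f from \<open>Y\<close> by zero. It replaces f
    because the minorants of \<open>P\<close> may depend on values outside \<open>Y\<close>.\<close>
  define r where "r f = (\<lambda>z. \<Sum>y\<in>Y. f y * \<delta> y z)" for f :: "'a \<Rightarrow> real"
  have r: "r f z = f z" if "z \<in> Y" for f z
    using that Y by (simp add: r_def \<delta>_def indicator_def if_distrib sum.delta cong: if_cong)
  have Pr: "P (r f) = P f" for f
    by (intro cong r)
  obtain P1 where P1: "sublinear P1" "\<And>f. P1 f \<le> P f" "P1 (\<lambda>y. - r w y) \<le> - P (r w)"
    using sublinear_linear_along[OF P] by blast
  obtain P2 where P2: "sublinear P2" "\<And>f. P2 f \<le> P1 f"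
    "\<And>y. y \<in> Y \<Longrightarrow> P2 (\<lambda>z. - \<delta> y z) \<le> - P2 (\<delta> y)"
    using sublinear_linear_along_finite[of "\<delta> ` Y" P1] P1(1) Y by (auto 0 4)
  define p where "p y = P2 (\<delta> y)" for y
  have le: "P2 (r f) \<le> (\<Sum>y\<in>Y. p y * f y)" for f
  proof -
    have "P2 (\<lambda>z. f y * \<delta> y z) \<le> p y * f y" if "y \<in> Y" for y
    proof (cases "f y \<ge> 0")
      case True
      then show ?thesis
        using sublinear_scale_le[OF P2(1), of "f y" "\<delta> y"] by (simp add: p_def mult.commute)
    next
      case False
      then have "P2 (\<lambda>z. (- f y) * (- \<delta> y z)) \<le> (- f y) * P2 (\<lambda>z. - \<delta> y z)"
        by (intro sublinear_scale_le P2(1)) auto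
      also have "\<dots> \<le> (- f y) * (- p y)"
        using P2(3)[OF that] False by (intro mult_left_mono) (auto simp: p_def)
      finally show ?thesis by (simp add: mult.commute)
    qed
    then have "(\<Sum>y\<in>Y. P2 (\<lambda>z. f y * \<delta> y z)) \<le> (\<Sum>y\<in>Y. p y * f y)"
      by (rule sum_mono)
    then show ?thesis
      using sublinear_sum[OF P2(1) Y, of "\<lambda>y z. f y * \<delta> y z"] by (simp add: r_def)
  qed
  have minus: "r (\<lambda>y. - f y) = (\<lambda>z. - r f z)" for f
    by (simp add: r_def sum_negf)
  have ge: "(\<Sum>y\<in>Y. p y * f y) \<le> P2 (r f)" for f
    using le[of "\<lambda>y. - f y"] sublinear_minus[OF P2(1), of "r f"] by (simp add: minus sum_negf)
  have "(\<Sum>y\<in>Y. p y * f y) \<le> P f" for f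
    using ge[of f] P2(2)[of "r f"] P1(2)[of "r f"] Pr[of f] by simp
  moreover have "P w \<le> (\<Sum>y\<in>Y. p y * w y)"
    using le[of w] sublinear_minus[OF P2(1), of "r w"] P2(2)[of "\<lambda>y. - r w y"] P1(3) Pr[of w]
    by simp
  ultimately show ?thesis using antisym by blast
qed

section \<open>Primitivity of strongly connected relations\<close>

text \<open>Let d be the least positive difference of two members, attained by a and a + d. For a
  member n and q = n div d, the members q (a + d) and n + q a differ by n mod d, so minimality makes
  this remainder zero. Hence d divides the gcd.\<close>

lemma semigroup_consecutive:
  fixes K :: "nat set"
  assumes add: "\<And>a b. a \<in> K \<Longrightarrow> b \<in> K \<Longrightarrow> a + b \<in> K" and "0 \<in> K" and "Gcd K = 1"
  shows "\<exists>a. a \<in> K \<and> a + 1 \<in> K"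
proof -
  define D where "D d \<longleftrightarrow> d > 0 \<and> (\<exists>a\<in>K. a + d \<in> K)" for d
  have mult: "q * a \<in> K" if "a \<in> K" for q a
    using that by (induction q) (auto intro: add \<open>0 \<in> K\<close>)
  obtain k where k: "k \<in> K" "k \<noteq> 0"
    using \<open>Gcd K = 1\<close> Gcd_0_iff[of K] by fastforce
  then have "D k" using \<open>0 \<in> K\<close> by (auto simp: D_def intro!: bexI[of _ 0])
  define d where "d = (LEAST d. D d)"
  have "D d" unfolding d_def by (rule LeastI) fact
  then obtain a where a: "d > 0" "a \<in> K" "a + d \<in> K" by (auto simp: D_def)
  have "d dvd n" if "n \<in> K" for n
  proof (rule ccontr)
    assume "\<not> d dvd n"
    then have "n mod d > 0" by (simp add: dvd_eq_mod_eq_0)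
    moreover have "(n div d) * (a + d) + n mod d = n + (n div d) * a"
      by (simp add: algebra_simps)
    ultimately have "D (n mod d)"
      using mult[OF a(3), of "n div d"] add[OF that mult[OF a(2), of "n div d"]]
      unfolding D_def by metis
    then have "d \<le> n mod d" unfolding d_def by (rule Least_le)
    then show False using mod_less_divisor[OF a(1), of n] by simp
  qed
  then have "d dvd Gcd K" by (rule Gcd_greatest)
  then show ?thesis using a \<open>Gcd K = 1\<close> by auto
qed

text \<open>With a and a + 1 in \<open>K\<close>, the number n = q a + r = (q - r) a + r (a + 1) is
  in \<open>K\<close> as soon as r \<le> q. For n \<ge> a * a and a > 0 this holds since r < a \<le>
  q; for a = 0 the member 1 generates everything.\<close>

lemma semigroup_eventually:
  fixes K :: "nat set"
  assumes add: "\<And>a b. a \<in> K \<Longrightarrow> b \<in> K \<Longrightarrow> a + b \<in> K" and "0 \<in> K" and "Gcd K = 1"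
  shows "\<exists>N. \<forall>n\<ge>N. n \<in> K"
proof -
  obtain a where a: "a \<in> K" "a + 1 \<in> K"
    using semigroup_consecutive[of K] assms by blast
  have mult: "q * b \<in> K" if "b \<in> K" for q b
    using that by (induction q) (auto intro: add \<open>0 \<in> K\<close>)
  show ?thesis
  proof (intro exI[of _ "a * a"] allI impI)
    fix n assume n: "n \<ge> a * a"
    show "n \<in> K"
    proof (cases "a = 0")
      case True
      then show ?thesis using mult[OF a(2), of n] by simp
    next
      case False
      define q r where "q = n div a" and "r = n mod a"
      have "a \<le> q" using n False by (simp add: q_def less_eq_div_iff_mult_less_eq)
      moreover have "r < a" using False by (simp add: r_def)
      ultimately have "r \<le> q" by simp
      then have "(q - r) * a + r * (a + 1) = q * a + r"
        by (simp add: diff_mult_distrib algebra_simps)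
      also have "\<dots> = n" by (simp add: q_def r_def)
      finally show ?thesis using add mult a by metis
    qed
  qed
qed

lemma relpow_mono:
  fixes R S :: "'a rel"
  shows "R \<subseteq> S \<Longrightarrow> R ^^ n \<subseteq> S ^^ n"
  by (induction n) (auto simp: relcomp_mono)

text \<open>Each vertex has closed walks of all large lengths. Appending a fixed connecting path
  reaches any target in all large lengths, and finiteness of \<open>C\<close> gives a common
  length.\<close>

lemma primitive_relation:
  fixes R :: "'a rel"
  assumes "finite C" and connected: "\<And>x y. x \<in> C \<Longrightarrow> y \<in> C \<Longrightarrow> (x, y) \<in> R\<^sup>*"
    and gcd: "Gcd {n. n \<ge> 1 \<and> (\<exists>x\<in>C. (x, x) \<in> R ^^ n)} = (1 :: nat)"
  shows "\<exists>N. \<forall>x\<in>C. \<forall>y\<in>C. (x, y) \<in> R ^^ N"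
proof -
  have trans: "(x, z) \<in> R ^^ (a + b)" if "(x, y) \<in> R ^^ a" "(y, z) \<in> R ^^ b" for x y z a b
    using that by (auto simp: relpow_add)
  have conn: "\<exists>n. (x, y) \<in> R ^^ n" if "x \<in> C" "y \<in> C" for x y
    using connected[OF that] by (rule rtrancl_imp_relpow[THEN exE]) blast
  have loops: "\<exists>N. \<forall>n\<ge>N. (x, x) \<in> R ^^ n" if x: "x \<in> C" for x
  proof -
    define K where "K = {n. (x, x) \<in> R ^^ n}"
    \<comment> \<open>Inserting a closed walk of length n at y into a round trip from x through y
      exhibits n as a difference of two return lengths at x. So the return lengths at x alone
      already have gcd 1.\<close>
    have "Gcd K dvd n" if n: "n \<ge> 1" "y \<in> C" "(y, y) \<in> R ^^ n" for y n
    proof -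
      obtain a b where ab: "(x, y) \<in> R ^^ a" "(y, x) \<in> R ^^ b"
        using conn x n(2) by blast
      then have "a + b \<in> K" "a + n + b \<in> K"
        using trans n(3) unfolding K_def by blast+
      then have "Gcd K dvd (a + n + b) - (a + b)"
        by (intro dvd_diff_nat Gcd_dvd)
      then show ?thesis by simp
    qed
    then have "Gcd K dvd Gcd {n. n \<ge> 1 \<and> (\<exists>x\<in>C. (x, x) \<in> R ^^ n)}"
      by (intro Gcd_greatest) auto
    then have "Gcd K = 1" using gcd by simp
    then have "\<exists>N. \<forall>n\<ge>N. n \<in> K"
      by (intro semigroup_eventually) (auto simp: K_def intro: trans)
    then show ?thesis by (simp add: K_def)
  qed
  have "\<forall>\<^sub>F n in sequentially. (x, y) \<in> R ^^ n" if xy: "x \<in> C" "y \<in> C" for x y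
  proof -
    obtain N where N: "\<And>n. n \<ge> N \<Longrightarrow> (x, x) \<in> R ^^ n" using loops[OF xy(1)] by blast
    obtain a where a: "(x, y) \<in> R ^^ a" using conn[OF xy] by blast
    show ?thesis
    proof (rule eventually_sequentiallyI)
      fix n assume "N + a \<le> n"
      then show "(x, y) \<in> R ^^ n"
        using trans[OF N[of "n - a"] a] by simp
    qed
  qed
  then have "\<forall>\<^sub>F n in sequentially. \<forall>x\<in>C. \<forall>y\<in>C. (x, y) \<in> R ^^ n"
    using \<open>finite C\<close> by (intro eventually_ball_finite ballI)
  then show ?thesis
    by (rule eventually_happens'[OF sequentially_bot])
qed

section \<open>Upper transition operators\<close>

locale upper_operator =
  fixes Y :: "'a set" and S :: "'a operator"
  assumes finite_states: "finite Y" and upper_transition: "upper_transition_operator Y S"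
begin

text \<open>Restricting the argument first makes the operator usable on every function, so that sums
  and multiples need not be cut down to \<open>fun_space Y\<close> each time.\<close>

definition up :: "'a operator" where
  "up f = S (restrict f Y)"

lemma operator_add:
  assumes "f \<in> fun_space Y" "g \<in> fun_space Y" "x \<in> Y"
  shows "S (\<lambda>y\<in>Y. f y + g y) x \<le> S f x + S g x"
  using upper_transition assms by (simp add: upper_transition_operator_def)

lemma operator_scale:
  assumes "c \<ge> 0" "f \<in> fun_space Y" "x \<in> Y"
  shows "S (\<lambda>y\<in>Y. c * f y) x = c * S f x"
  using upper_transition assms by (simp add: upper_transition_operator_def)

lemma operator_le_Max:
  assumes "f \<in> fun_space Y" "x \<in> Y"
  shows "S f x \<le> Max (f ` Y)"
  using upper_transition assms by (simp add: upper_transition_operator_def)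

lemma closed_fun_space: "f \<in> fun_space Y \<Longrightarrow> S f \<in> fun_space Y"
  using upper_transition unfolding upper_transition_operator_def by blast

lemma up_cong: "(\<And>y. y \<in> Y \<Longrightarrow> f y = g y) \<Longrightarrow> up f = up g"
  unfolding up_def by (rule arg_cong[where f = S]) (rule restrict_ext)

lemma up_eq: "f \<in> fun_space Y \<Longrightarrow> up f = S f"
  by (simp add: up_def PiE_restrict)

lemma up_add:
  assumes "x \<in> Y"
  shows "up (\<lambda>y. f y + g y) x \<le> up f x + up g x"
proof -
  have "restrict h Y \<in> fun_space Y" for h :: "'a \<Rightarrow> real" by simp
  then have "up (\<lambda>y. restrict f Y y + restrict g Y y) x \<le> up f x + up g x"
    unfolding up_def using assms by (intro operator_add)
  moreover have "up (\<lambda>y. restrict f Y y + restrict g Y y) = up (\<lambda>y. f y + g y)"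
    by (rule up_cong) simp
  ultimately show ?thesis by (simp only:)
qed

lemma up_scale:
  assumes "x \<in> Y" "c \<ge> 0"
  shows "up (\<lambda>y. c * f y) x = c * up f x"
proof -
  have "restrict f Y \<in> fun_space Y" by simp
  then have "up (\<lambda>y. c * restrict f Y y) x = c * up f x"
    unfolding up_def using assms by (intro operator_scale)
  moreover have "up (\<lambda>y. c * restrict f Y y) = up (\<lambda>y. c * f y)"
    by (rule up_cong) simp
  ultimately show ?thesis by (simp only:)
qed

lemma up_le_const:
  assumes "x \<in> Y" "\<And>y. y \<in> Y \<Longrightarrow> f y \<le> c"
  shows "up f x \<le> c"
proof -
  have "restrict f Y \<in> fun_space Y" by simp
  then have "up f x \<le> Max (restrict f Y ` Y)"
    unfolding up_def using assms(1) by (intro operator_le_Max)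
  also have "\<dots> = Max (f ` Y)" by (simp cong: image_cong)
  also have "\<dots> \<le> c"
    using assms finite_states by (subst Max_le_iff) auto
  finally show ?thesis .
qed

lemma up_sublinear: "x \<in> Y \<Longrightarrow> sublinear (\<lambda>f. up f x)"
  unfolding sublinear_def by (intro conjI allI impI up_add eq_refl[OF up_scale])

lemma up_zero: "x \<in> Y \<Longrightarrow> up (\<lambda>y. 0) x = 0"
  using sublinear_zero[OF up_sublinear] .

lemma up_le_up_plus:
  assumes "x \<in> Y" "\<And>y. y \<in> Y \<Longrightarrow> f y \<le> g y + c"
  shows "up f x \<le> up g x + c"
proof -
  have "up f x = up (\<lambda>y. g y + (f y - g y)) x" by simp
  also have "\<dots> \<le> up g x + up (\<lambda>y. f y - g y) x" using assms(1) by (rule up_add)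
  also have "up (\<lambda>y. f y - g y) x \<le> c"
    using assms by (intro up_le_const) (auto simp: algebra_simps)
  finally show ?thesis by simp
qed

lemma up_mono: "x \<in> Y \<Longrightarrow> (\<And>y. y \<in> Y \<Longrightarrow> f y \<le> g y) \<Longrightarrow> up f x \<le> up g x"
  using up_le_up_plus[of x f g 0] by simp

lemma up_const: "x \<in> Y \<Longrightarrow> up (\<lambda>y. c) x = c"
  using up_le_const[of x "\<lambda>y. c" c] up_le_const[of x "\<lambda>y. - c" "- c"]
    sublinear_minus[OF up_sublinear, of x "\<lambda>y. c"] by simp

lemma up_ge_const: "x \<in> Y \<Longrightarrow> (\<And>y. y \<in> Y \<Longrightarrow> c \<le> f y) \<Longrightarrow> c \<le> up f x"
  using up_mono[of x "\<lambda>y. c" f] up_const by simp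

lemma up_add_const:
  assumes "x \<in> Y"
  shows "up (\<lambda>y. c + f y) x = c + up f x"
proof (rule antisym)
  show "up (\<lambda>y. c + f y) x \<le> c + up f x"
    using up_le_up_plus[of x "\<lambda>y. c + f y" f c] assms by simp
  show "c + up f x \<le> up (\<lambda>y. c + f y) x"
    using up_le_up_plus[of x f "\<lambda>y. c + f y" "- c"] assms by simp
qed

lemma up_indicator: "S (ind Y A) = up (indicator A)"
  unfolding up_def ind_def by (rule refl)

lemma up_indicator_ge_0: "x \<in> Y \<Longrightarrow> 0 \<le> up (indicator A) x"
  using up_ge_const[of x 0 "indicator A"] by simp

text \<open>If the upper probability of leaving \<open>C\<close> from x is nonpositive, values
  outside \<open>C\<close> cannot raise the result: the excess there is at most \<open>K\<close>
  times the indicator of \<open>Y - C\<close>.\<close>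

lemma up_restrict_closed:
  assumes "C \<subseteq> Y" "x \<in> C" "up (indicator (Y - C)) x \<le> 0" "\<And>y. y \<in> C \<Longrightarrow> f y \<le> g y"
  shows "up f x \<le> up g x"
proof -
  define K where "K = (\<Sum>y\<in>Y. \<bar>f y - g y\<bar>)"
  have x: "x \<in> Y" using assms(1,2) by blast
  have K: "K \<ge> 0" unfolding K_def by (rule sum_nonneg) simp
  have "f y \<le> g y + K * indicator (Y - C) y" if "y \<in> Y" for y
  proof (cases "y \<in> C")
    case False
    have "\<bar>f y - g y\<bar> \<le> K"
      unfolding K_def using that finite_states by (intro member_le_sum) auto
    then show ?thesis using False that by simp
  qed (simp add: assms(4))
  then have "up f x \<le> up (\<lambda>y. g y + K * indicator (Y - C) y) x"
    using x by (intro up_mono)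
  also have "\<dots> \<le> up g x + K * up (indicator (Y - C)) x"
    using up_add[OF x, of g "\<lambda>y. K * indicator (Y - C) y"] up_scale[OF x K, of "indicator (Y - C)"]
    by simp
  also have "\<dots> \<le> up g x" using assms(3) K by (simp add: mult_nonneg_nonpos)
  finally show ?thesis .
qed

section \<open>Iterates of an upper transition operator\<close>

lemma upper_operator_comp:
  assumes "upper_transition_operator Y S'"
  shows "upper_transition_operator Y (S \<circ> S')"
proof -
  interpret S': upper_operator Y S'
    using finite_states assms by unfold_locales
  have S'_up: "S (S' f) = up (S' f)" if "f \<in> fun_space Y" for f
    using up_eq[OF S'.closed_fun_space[OF that]] by simp
  have mem: "(\<lambda>y\<in>Y. h y) \<in> fun_space Y" for h :: "'a \<Rightarrow> real" by simp
  have "S (S' (\<lambda>y\<in>Y. f y + g y)) x \<le> S (S' f) x + S (S' g) x"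
    if "f \<in> fun_space Y" "g \<in> fun_space Y" "x \<in> Y" for f g x
  proof -
    have "up (S'.up (\<lambda>y. f y + g y)) x \<le> up (\<lambda>y. S' f y + S' g y) x"
      using that S'.up_add[of _ f g] by (intro up_mono) (auto simp: S'.up_eq)
    also have "\<dots> \<le> up (S' f) x + up (S' g) x" using that by (intro up_add)
    finally show ?thesis using that by (simp add: S'_up S'.up_def mem)
  qed
  moreover have "S (S' (\<lambda>y\<in>Y. c * f y)) x = c * S (S' f) x"
    if "c \<ge> 0" "f \<in> fun_space Y" "x \<in> Y" for c f x
  proof -
    have "up (S'.up (\<lambda>y. c * f y)) = up (\<lambda>y. c * S' f y)"
      using that S'.up_scale[of _ c f] by (intro up_cong) (auto simp: S'.up_eq)
    then show ?thesis using that up_scale[of x c "S' f"] by (simp add: S'_up S'.up_def mem)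
  qed
  moreover have "S (S' f) x \<le> Max (f ` Y)" if "f \<in> fun_space Y" "x \<in> Y" for f x
  proof -
    have "up (S' f) x \<le> Max (f ` Y)"
      using that finite_states S'.up_le_const[of _ f "Max (f ` Y)"]
      by (intro up_le_const) (auto simp: S'.up_eq)
    then show ?thesis using that by (simp add: S'_up)
  qed
  ultimately show ?thesis
    unfolding upper_transition_operator_def
    using closed_fun_space S'.closed_fun_space by auto
qed

text \<open>Makes all facts about upper transition operators available for the iterates.\<close>

lemma upper_operator_power: "upper_operator Y (S ^^ n)"
proof -
  have "upper_transition_operator Y (S ^^ n)"
  proof (induction n)
    case 0
    then show ?case
      unfolding upper_transition_operator_def
      using finite_states by (auto intro!: Max_ge)
  next
    case (Suc n)
    then show ?case using upper_operator_comp by (simp add: comp_def)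
  qed
  then show ?thesis using finite_states by unfold_locales
qed

lemma power_fun_space: "f \<in> fun_space Y \<Longrightarrow> (S ^^ n) f \<in> fun_space Y"
  using upper_operator.closed_fun_space[OF upper_operator_power] .

text \<open>A closed set stays closed under iteration: the previous iterate is nonpositive on
  \<open>C\<close>, and only its values on \<open>C\<close> count.\<close>

lemma closed_power:
  assumes "C \<subseteq> Y" "x \<in> C" "\<And>x. x \<in> C \<Longrightarrow> up (indicator (Y - C)) x \<le> 0"
  shows "(S ^^ n) (ind Y (Y - C)) x \<le> 0"
  using assms(2)
proof (induction n arbitrary: x)
  case 0
  then show ?case using assms(1) by (auto simp: ind_def)
next
  case (Suc n)
  let ?h = "(S ^^ n) (ind Y (Y - C))"
  have "up ?h x \<le> up (\<lambda>y. 0) x"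
    using Suc assms by (intro up_restrict_closed[of C]) auto
  moreover have "up ?h = S ?h"
    by (intro up_eq power_fun_space) (simp add: ind_def)
  ultimately show ?case
    using up_zero Suc assms(1) by auto
qed

text \<open>If the first edge leads to z, the remaining iterate dominates its own positive value at
  z times the indicator of z, whose upper value at x is positive.\<close>

lemma power_pos_of_path:
  assumes "x \<in> Y" "(x, y) \<in> upper_graph Y S ^^ n"
  shows "(S ^^ n) (ind Y {y}) x > 0"
  using assms
proof (induction n arbitrary: x)
  case 0
  then show ?case by (auto simp: ind_def)
next
  case (Suc n)
  obtain z where z: "(x, z) \<in> upper_graph Y S" "(z, y) \<in> upper_graph Y S ^^ n"
    using relpow_Suc_D2[OF Suc.prems(2)] by blast
  then have zY: "z \<in> Y" and xz: "up (indicator {z}) x > 0"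
    by (auto simp: upper_graph_def up_indicator)
  let ?h = "(S ^^ n) (ind Y {y})"
  have hz: "?h z > 0" using Suc.IH[OF zY z(2)] .
  have "?h v \<ge> 0" if "v \<in> Y" for v
    using upper_operator.up_indicator_ge_0[OF upper_operator_power[of n] that, of "{y}"]
      upper_operator.up_indicator[OF upper_operator_power[of n], of "{y}"] by simp
  then have "up (\<lambda>v. ?h z * indicator {z} v) x \<le> up ?h x"
    using Suc.prems(1) by (intro up_mono) (auto split: split_indicator)
  then have "?h z * up (indicator {z}) x \<le> up ?h x"
    using up_scale[of x "?h z" "indicator {z}"] Suc.prems(1) hz by simp
  moreover have "up ?h = S ?h"
    by (intro up_eq power_fun_space) (simp add: ind_def)
  ultimately show ?case using mult_pos_pos[OF hz xz] by simp
qed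

section \<open>Maximal communication classes\<close>

lemma equiv_communication: "equiv Y (communication Y S)"
  by (rule equivI)
    (auto simp: communication_def accessible_def refl_on_def sym_def trans_def intro: rtrancl_trans)

lemma maximal_class_subset: "C \<in> maximal_classes Y S \<Longrightarrow> C \<subseteq> Y"
  unfolding maximal_classes_def communication_classes_def
  using in_quotient_imp_subset[OF equiv_communication] by blast

lemma maximal_class_nonempty: "C \<in> maximal_classes Y S \<Longrightarrow> C \<noteq> {}"
  unfolding maximal_classes_def communication_classes_def
  using in_quotient_imp_non_empty[OF equiv_communication] by blast

lemma maximal_class_step:
  assumes "C \<in> maximal_classes Y S" "x \<in> C" "(x, y) \<in> upper_graph Y S"
  shows "y \<in> C"
  using assms unfolding maximal_classes_def accessible_def upper_graph_def by blast

lemma maximal_class_connected: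
  assumes C: "C \<in> maximal_classes Y S" and xy: "x \<in> C" "y \<in> C"
  shows "(x, y) \<in> (upper_graph Y S \<inter> C \<times> C)\<^sup>*"
proof -
  have "(x, y) \<in> communication Y S"
    using in_quotient_imp_in_rel[OF equiv_communication, of C x y] C xy
    unfolding maximal_classes_def communication_classes_def by blast
  then have "(x, y) \<in> (upper_graph Y S)\<^sup>*"
    by (simp add: communication_def accessible_def)
  then have "y \<in> C \<and> (x, y) \<in> (upper_graph Y S \<inter> C \<times> C)\<^sup>*"
  proof induction
    case base
    then show ?case using xy by simp
  next
    case (step y z)
    then have "z \<in> C" using maximal_class_step[OF C] by blast
    then have "(y, z) \<in> upper_graph Y S \<inter> C \<times> C" using step by blast
    then show ?case using step \<open>z \<in> C\<close> by (auto intro: rtrancl_into_rtrancl)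
  qed
  then show ?thesis ..
qed

text \<open>No edge leaves a maximal class, so every single outside point has nonpositive upper
  probability; subadditivity adds these up.\<close>

lemma maximal_class_closed:
  assumes C: "C \<in> maximal_classes Y S" and x: "x \<in> C"
  shows "up (indicator (Y - C)) x \<le> 0"
proof -
  have xY: "x \<in> Y" using maximal_class_subset[OF C] x by blast
  have "up (indicator (Y - C)) = up (\<lambda>z. \<Sum>y\<in>Y - C. indicator {y} z)"
    using finite_states by (intro up_cong) (auto simp: indicator_def sum.delta')
  then have "up (indicator (Y - C)) x \<le> (\<Sum>y\<in>Y - C. up (indicator {y}) x)"
    using sublinear_sum[OF up_sublinear[OF xY], of "Y - C" "\<lambda>y. indicator {y}"] finite_states
    by simp
  also have "\<dots> \<le> 0"
    using maximal_class_step[OF C x] xY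
    by (intro sum_nonpos) (auto simp: upper_graph_def up_indicator not_less[symmetric])
  finally show ?thesis .
qed

text \<open>Regularity gives an N at which the iterates of all point indicators of \<open>C\<close>
  are positive on \<open>C\<close>; \<open>\<epsilon>\<close> is the least of these finitely many
  values. On \<open>C\<close>, g dominates m plus g y - m times the indicator of y, and N steps turn
  this into the bound. Its uniformity in g, m and n allows its use along a whole orbit.\<close>

lemma regular_class_contraction:
  assumes C: "C \<in> maximal_classes Y S" and reg: "regular_class Y S C"
  shows "\<exists>N. \<exists>\<epsilon>>0. (\<forall>g m n. \<forall>x\<in>C. \<forall>y\<in>C. n \<ge> N \<longrightarrow> (\<forall>z\<in>C. m \<le> g z) \<longrightarrow>
           m + \<epsilon> * (g y - m) \<le> (S ^^ n) (restrict g Y) x)"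
proof -
  have CY: "C \<subseteq> Y" and "finite C" and "C \<noteq> {}"
    using maximal_class_subset[OF C] maximal_class_nonempty[OF C] finite_states
    by (auto intro: finite_subset)
  obtain N where N: "\<And>x y. x \<in> C \<Longrightarrow> y \<in> C \<Longrightarrow> (x, y) \<in> (upper_graph Y S \<inter> C \<times> C) ^^ N"
    using primitive_relation[of C "upper_graph Y S \<inter> C \<times> C"] \<open>finite C\<close>
      maximal_class_connected[OF C] reg
    unfolding regular_class_def by blast
  define P where "P x y = (S ^^ N) (ind Y {y}) x" for x y
  have P: "P x y > 0" if "x \<in> C" "y \<in> C" for x y
  proof -
    have "(x, y) \<in> upper_graph Y S ^^ N"
      using N[OF that] relpow_mono[of "upper_graph Y S \<inter> C \<times> C" "upper_graph Y S" N] by blast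
    then show ?thesis unfolding P_def using CY that by (intro power_pos_of_path) auto
  qed
  define \<epsilon> where "\<epsilon> = Min ((\<lambda>(x, y). P x y) ` (C \<times> C))"
  have "\<epsilon> > 0" unfolding \<epsilon>_def using \<open>finite C\<close> \<open>C \<noteq> {}\<close> P by (subst Min_gr_iff) auto
  have \<epsilon>_le: "\<epsilon> \<le> P x y" if "x \<in> C" "y \<in> C" for x y
    unfolding \<epsilon>_def using \<open>finite C\<close> that by (intro Min_le) auto
  have closed: "upper_operator.up Y (S ^^ n) (indicator (Y - C)) x \<le> 0" if "x \<in> C" for x n
    using closed_power[OF CY that maximal_class_closed[OF C], of n]
      upper_operator.up_indicator[OF upper_operator_power[of n], of "Y - C"] by simp
  interpret SN: upper_operator Y "S ^^ N" by (rule upper_operator_power)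
  have "m + \<epsilon> * (g y - m) \<le> (S ^^ n) (restrict g Y) x"
    if xy: "x \<in> C" "y \<in> C" and n: "n \<ge> N" and m: "\<forall>z\<in>C. m \<le> g z" for g m n x y
  proof -
    let ?h = "SN.up g"
    have step: "m + \<epsilon> * (g y - m) \<le> ?h x" if x: "x \<in> C" for x
    proof -
      have xY: "x \<in> Y" using x CY by blast
      have "m + \<epsilon> * (g y - m) \<le> m + (g y - m) * P x y"
        using m xy \<epsilon>_le[OF x xy(2)] by (simp add: mult.commute[of "g y - m"] mult_right_mono)
      also have "\<dots> = SN.up (\<lambda>z. m + (g y - m) * indicator {y} z) x"
        using m xy SN.up_add_const[OF xY] SN.up_scale[OF xY, of "g y - m" "indicator {y}"]
        by (simp add: P_def SN.up_indicator)
      also have "\<dots> \<le> ?h x"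
        using m by (intro SN.up_restrict_closed[OF CY x closed[OF x]])
          (auto split: split_indicator)
      finally show ?thesis .
    qed
    \<comment> \<open>After N steps the lower bound is constant on the closed set \<open>C\<close>,
      so the remaining n - N steps preserve it.\<close>
    interpret R: upper_operator Y "S ^^ (n - N)" by (rule upper_operator_power)
    have xY: "x \<in> Y" using xy CY by blast
    have "R.up (\<lambda>z. m + \<epsilon> * (g y - m)) x \<le> R.up ?h x"
      using step by (intro R.up_restrict_closed[OF CY xy(1) closed[OF xy(1)]])
    moreover have "R.up ?h = (S ^^ (n - N)) ((S ^^ N) (restrict g Y))"
      unfolding SN.up_def by (intro R.up_eq SN.closed_fun_space) simp
    moreover have "(S ^^ (n - N)) ((S ^^ N) (restrict g Y)) = (S ^^ n) (restrict g Y)"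
      using n by (metis comp_apply funpow_add le_add_diff_inverse2)
    ultimately show ?thesis using R.up_const[OF xY] by simp
  qed
  then show ?thesis using \<open>\<epsilon> > 0\<close> by blast
qed

subsection \<open>Credal sets and restriction\<close>

lemma credal_le_up:
  assumes "p \<in> credal_set Y S x"
  shows "(\<Sum>y\<in>Y. p y * f y) \<le> up f x"
proof -
  have "restrict f Y \<in> fun_space Y" by simp
  then have "(\<Sum>y\<in>Y. p y * restrict f Y y) \<le> up f x"
    using assms unfolding credal_set_def up_def by blast
  then show ?thesis by simp
qed

lemma credal_nonneg: "p \<in> credal_set Y S x \<Longrightarrow> y \<in> Y \<Longrightarrow> p y \<ge> 0"
  and credal_sum: "p \<in> credal_set Y S x \<Longrightarrow> (\<Sum>y\<in>Y. p y) = 1"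
  unfolding credal_set_def mass_functions_def by auto

text \<open>The operator is the upper envelope of its credal set. A supporting functional at w is a
  mass function: negated indicators test nonnegativity, the constants 1 and -1 test the total
  mass.\<close>

lemma credal_attains:
  assumes x: "x \<in> Y"
  shows "\<exists>p\<in>credal_set Y S x. (\<Sum>y\<in>Y. p y * w y) = up w x"
proof -
  have "up f x = up g x" if "\<And>y. y \<in> Y \<Longrightarrow> f y = g y" for f g
    using up_cong[OF that] by simp
  from sublinear_supporting_functional[OF up_sublinear[OF x] finite_states this, of w]
  obtain p where p: "\<And>f. (\<Sum>y\<in>Y. p y * f y) \<le> up f x" "(\<Sum>y\<in>Y. p y * w y) = up w x"
    by blast
  have "p y \<ge> 0" if "y \<in> Y" for y
  proof -
    have "(\<Sum>z\<in>Y. p z * - indicator {y} z) = - p y"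
      using that finite_states by (simp add: indicator_def if_distrib sum_negf cong: if_cong)
    then show ?thesis
      using p(1)[of "\<lambda>z. - indicator {y} z"] up_le_const[of x "\<lambda>z. - indicator {y} z" 0] x
      by auto
  qed
  moreover have "(\<Sum>y\<in>Y. p y) = 1"
    using p(1)[of "\<lambda>_. 1"] p(1)[of "\<lambda>_. - 1"] up_const[OF x] by (simp add: sum_negf)
  moreover have "(\<Sum>y\<in>Y. p y * f y) \<le> S f x" if "f \<in> fun_space Y" for f
    using p(1)[of f] up_eq[OF that] by simp
  ultimately have "restrict p Y \<in> credal_set Y S x"
    unfolding credal_set_def mass_functions_def by simp
  then show ?thesis using p(2) by (intro bexI[of _ "restrict p Y"]) auto
qed

lemma sum_restricted:
  assumes "Z \<subseteq> Y" "\<forall>y\<in>Y - Z. p y = 0"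
  shows "(\<Sum>y\<in>Z. restrict p Z y * g y) = (\<Sum>y\<in>Y. p y * g y :: real)"
proof -
  have "(\<Sum>y\<in>Z. restrict p Z y * g y) = (\<Sum>y\<in>Z. p y * g y)" by simp
  also have "\<dots> = (\<Sum>y\<in>Y. p y * g y)"
    using assms finite_states by (intro sum.mono_neutral_left) auto
  finally show ?thesis .
qed

context
  fixes Z
  assumes ZY: "Z \<subseteq> Y" and nonempty: "\<And>x. x \<in> Z \<Longrightarrow> restricted_credal_set Y S Z x \<noteq> {}"
begin

lemma restricted_attains:
  assumes "x \<in> Z"
  obtains q where "q \<in> restricted_credal_set Y S Z x"
    "restricted_operator Y S Z g x = (\<Sum>y\<in>Z. q y * g y)"
  using restricted_operator_max[OF finite_states ZY assms nonempty[OF assms], of g] by blast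

lemma restricted_ge:
  assumes "x \<in> Z" "q \<in> restricted_credal_set Y S Z x"
  shows "(\<Sum>y\<in>Z. q y * g y) \<le> restricted_operator Y S Z g x"
proof -
  obtain r where "restricted_operator Y S Z g x = (\<Sum>y\<in>Z. r y * g y)"
    "\<forall>q\<in>restricted_credal_set Y S Z x. (\<Sum>y\<in>Z. q y * g y) \<le> (\<Sum>y\<in>Z. r y * g y)"
    using restricted_operator_max[OF finite_states ZY assms(1) nonempty[OF assms(1)], of g] by blast
  then show ?thesis using assms(2) by simp
qed

text \<open>The maximising restricted mass function comes from a member of the credal set that
  vanishes outside \<open>Z\<close>, so its expectation is one that \<open>up\<close>
  dominates.\<close>

lemma restricted_le_up:
  assumes "x \<in> Z"
  shows "restricted_operator Y S Z (restrict f Z) x \<le> up f x"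
proof -
  obtain q where q: "q \<in> restricted_credal_set Y S Z x"
    "restricted_operator Y S Z (restrict f Z) x = (\<Sum>y\<in>Z. q y * restrict f Z y)"
    using restricted_attains[OF assms] .
  from q(1) obtain p where p: "p \<in> credal_set Y S x" "\<forall>y\<in>Y - Z. p y = 0" "q = restrict p Z"
    unfolding restricted_credal_set_def by blast
  have "(\<Sum>y\<in>Z. q y * restrict f Z y) = (\<Sum>y\<in>Y. p y * f y)"
    using sum_restricted[OF ZY p(2), of f] p(3) by simp
  then show ?thesis using credal_le_up[OF p(1)] q(2) by simp
qed

lemma restricted_mass:
  assumes "q \<in> restricted_credal_set Y S Z x"
  shows "q \<in> mass_functions Z"
proof -
  from assms obtain p where p: "p \<in> credal_set Y S x" "\<forall>y\<in>Y - Z. p y = 0" "q = restrict p Z"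
    unfolding restricted_credal_set_def by blast
  have "(\<Sum>y\<in>Z. q y) = 1"
    using sum_restricted[OF ZY p(2), of "\<lambda>_. 1"] credal_sum[OF p(1)] p(3) by simp
  then show ?thesis
    using credal_nonneg[OF p(1)] ZY p(3) by (auto simp: mass_functions_def)
qed

text \<open>Each axiom is checked at a mass function attaining the restricted maximum.\<close>

lemma restricted_upper_operator: "upper_operator Z (restricted_operator Y S Z)"
proof
  let ?R = "restricted_operator Y S Z"
  show fin: "finite Z" using ZY finite_states by (rule finite_subset)
  have "?R (\<lambda>y\<in>Z. f y + g y) x \<le> ?R f x + ?R g x" if x: "x \<in> Z" for f g x
  proof -
    obtain q where q: "q \<in> restricted_credal_set Y S Z x"
      "?R (\<lambda>y\<in>Z. f y + g y) x = (\<Sum>y\<in>Z. q y * (\<lambda>y\<in>Z. f y + g y) y)"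
      using restricted_attains[OF x] .
    have "(\<Sum>y\<in>Z. q y * (\<lambda>y\<in>Z. f y + g y) y) = (\<Sum>y\<in>Z. q y * f y) + (\<Sum>y\<in>Z. q y * g y)"
      by (simp add: distrib_left sum.distrib)
    then show ?thesis
      using restricted_ge[OF x q(1), of f] restricted_ge[OF x q(1), of g] q(2) by simp
  qed
  moreover have "?R (\<lambda>y\<in>Z. c * f y) x = c * ?R f x" if x: "x \<in> Z" and c: "c \<ge> 0" for c f x
  proof (rule antisym)
    have eq: "(\<Sum>y\<in>Z. q y * (\<lambda>y\<in>Z. c * f y) y) = c * (\<Sum>y\<in>Z. q y * f y)" for q
      by (simp add: sum_distrib_left mult.left_commute)
    obtain q where "q \<in> restricted_credal_set Y S Z x"
      "?R (\<lambda>y\<in>Z. c * f y) x = (\<Sum>y\<in>Z. q y * (\<lambda>y\<in>Z. c * f y) y)"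
      using restricted_attains[OF x] .
    then show "?R (\<lambda>y\<in>Z. c * f y) x \<le> c * ?R f x"
      using restricted_ge[OF x, of q f] c unfolding eq by (simp add: mult_left_mono)
    obtain q' where "q' \<in> restricted_credal_set Y S Z x" "?R f x = (\<Sum>y\<in>Z. q' y * f y)"
      using restricted_attains[OF x] .
    then show "c * ?R f x \<le> ?R (\<lambda>y\<in>Z. c * f y) x"
      using restricted_ge[OF x, of q' "\<lambda>y\<in>Z. c * f y"] unfolding eq by simp
  qed
  moreover have "?R f x \<le> Max (f ` Z)" if x: "x \<in> Z" for f x
  proof -
    obtain q where q: "q \<in> restricted_credal_set Y S Z x" "?R f x = (\<Sum>y\<in>Z. q y * f y)"
      using restricted_attains[OF x] .
    have "(\<Sum>y\<in>Z. q y * f y) \<le> (\<Sum>y\<in>Z. q y * Max (f ` Z))"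
      using restricted_mass[OF q(1)] fin
      by (intro sum_mono mult_left_mono) (auto simp: mass_functions_def)
    also have "\<dots> = Max (f ` Z)"
      using restricted_mass[OF q(1)] by (simp add: mass_functions_def flip: sum_distrib_right)
    finally show ?thesis using q(2) by simp
  qed
  moreover have "?R f \<in> fun_space Z" for f
    by (auto simp: restricted_operator_def)
  ultimately show "upper_transition_operator Z ?R"
    unfolding upper_transition_operator_def by simp
qed

text \<open>Hands mass functions that live on \<open>Z\<close> down to the next stage of the
  decomposition.\<close>

lemma restricted_credal:
  assumes "x \<in> Z" "p \<in> credal_set Y S x" "\<forall>y\<in>Y - Z. p y = 0"
  shows "restrict p Z \<in> credal_set Z (restricted_operator Y S Z) x"
proof -
  have q: "restrict p Z \<in> restricted_credal_set Y S Z x"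
    using assms unfolding restricted_credal_set_def by blast
  then show ?thesis
    unfolding credal_set_def
    by (intro CollectI conjI ballI restricted_mass[OF q] restricted_ge[OF assms(1) q])
qed

end

subsection \<open>The residual part\<close>

lemma maximal_part_subset: "maximal_part Y S \<subseteq> Y"
  unfolding maximal_part_def using maximal_class_subset by blast

lemma residual_part_subset: "residual_part Y S \<subseteq> Y"
  unfolding residual_part_def by blast

lemma lower_conjugate_apply: "x \<in> Y \<Longrightarrow> lower_conjugate Y S f x = - up (\<lambda>y. - f y) x"
  by (simp add: lower_conjugate_def up_def)

lemma lower_conjugate_le_expectation:
  assumes "x \<in> Y" "p \<in> credal_set Y S x"
  shows "lower_conjugate Y S f x \<le> (\<Sum>y\<in>Y. p y * f y)"
  using credal_le_up[OF assms(2), of "\<lambda>y. - f y"] assms(1)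
  by (simp add: lower_conjugate_apply sum_negf)

lemma lower_conjugate_mono:
  assumes "x \<in> Y" "\<And>y. y \<in> Y \<Longrightarrow> f y \<le> g y"
  shows "lower_conjugate Y S f x \<le> lower_conjugate Y S g x"
  using up_mono[of x "\<lambda>y. - g y" "\<lambda>y. - f y"] assms by (simp add: lower_conjugate_apply)

text \<open>This makes the restriction to the residual part well defined. The lower probabilities
  \<open>h n\<close> of the maximal part increase with n, so a single n makes them positive at all
  other states at once. At a residual state the least expectation of \<open>h n\<close> is
  \<open>h (Suc n)\<close>, which is nonpositive, so a minimising mass function avoids all states
  where \<open>h n\<close> is positive.\<close>

lemma residual_part_credal:
  assumes x: "x \<in> residual_part Y S"
  shows "\<exists>p\<in>credal_set Y S x. \<forall>y\<in>Y - residual_part Y S. p y = 0"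
proof -
  define M where "M = maximal_part Y S"
  define h where "h n = (lower_conjugate Y S ^^ n) (ind Y M)" for n
  have h_Suc: "h (Suc n) = lower_conjugate Y S (h n)" for n by (simp add: h_def)
  have MY: "M \<subseteq> Y" unfolding M_def by (rule maximal_part_subset)
  \<comment> \<open>Maximal classes are closed, so from a state of \<open>M\<close> the lower
    probability of still being in \<open>M\<close> after one step is 1; off \<open>M\<close> the
    initial value is 0.\<close>
  have base: "h 0 y \<le> h 1 y" if y: "y \<in> Y" for y
  proof (cases "y \<in> M")
    case True
    then obtain C where C: "C \<in> maximal_classes Y S" "y \<in> C"
      unfolding M_def maximal_part_def by blast
    then have "C \<subseteq> M" unfolding M_def maximal_part_def by blast
    then have "up (\<lambda>z. - ind Y M z) y \<le> up (\<lambda>z. - 1) y"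
      by (intro up_restrict_closed[OF maximal_class_subset[OF C(1)] C(2)]
          maximal_class_closed C) (use MY in \<open>auto simp: ind_def\<close>)
    then have "1 \<le> h 1 y"
      using up_const[OF y, of "- 1"] y by (simp add: h_def lower_conjugate_apply)
    then show ?thesis using True y by (simp add: h_def ind_def)
  next
    case False
    have "up (\<lambda>z. - ind Y M z) y \<le> 0"
      using y by (intro up_le_const) (auto simp: ind_def)
    then show ?thesis using False y by (simp add: h_def ind_def lower_conjugate_apply)
  qed
  have step: "h n y \<le> h (Suc n) y" if "y \<in> Y" for n y
    using that
  proof (induction n arbitrary: y)
    case 0
    then show ?case using base by simp
  next
    case (Suc n)
    then show ?case unfolding h_Suc[of n] h_Suc[of "Suc n"] by (intro lower_conjugate_mono)
  qed
  have mono: "h m y \<le> h n y" if "y \<in> Y" "m \<le> n" for m n y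
    using lift_Suc_mono_le[of "\<lambda>n. h n y", OF step[OF that(1)] that(2)] .
  have h0: "h 0 y \<ge> 0" if "y \<in> Y" for y
    using that by (simp add: h_def ind_def)
  have "\<forall>\<^sub>F n in sequentially. h n y > 0" if y: "y \<in> Y - residual_part Y S" for y
  proof -
    obtain k where "h k y > 0"
    proof (cases "y \<in> M")
      case True
      then have "h 0 y > 0" using y by (simp add: h_def ind_def)
      then show ?thesis using that by blast
    next
      case False
      then have "lower_reachable Y S M y"
        using y unfolding residual_part_def M_def by blast
      then show ?thesis using that unfolding lower_reachable_def h_def by blast
    qed
    then show ?thesis
      using mono y by (intro eventually_sequentiallyI[of k]) (auto intro: less_le_trans)
  qed
  then have "\<forall>\<^sub>F n in sequentially. \<forall>y\<in>Y - residual_part Y S. h n y > 0"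
    using finite_states by (intro eventually_ball_finite) auto
  then obtain n where n: "\<And>y. y \<in> Y - residual_part Y S \<Longrightarrow> h n y > 0"
    by (auto simp: eventually_sequentially)
  have xY: "x \<in> Y" using x residual_part_subset by blast
  \<comment> \<open>Maximising the expectation of the negated function minimises that of
    \<open>h n\<close>.\<close>
  obtain p where p: "p \<in> credal_set Y S x" "(\<Sum>y\<in>Y. p y * - h n y) = up (\<lambda>y. - h n y) x"
    using credal_attains[OF xY, of "\<lambda>y. - h n y"] by blast
  have "(\<Sum>y\<in>Y. p y * h n y) = h (Suc n) x"
    using p(2) xY by (simp add: h_Suc lower_conjugate_apply sum_negf)
  also have "\<dots> \<le> 0"
    using x unfolding residual_part_def lower_reachable_def h_def M_def by (auto simp: not_less)
  finally have le: "(\<Sum>y\<in>Y. p y * h n y) \<le> 0" .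
  have nonneg: "p y * h n y \<ge> 0" if "y \<in> Y" for y
    using credal_nonneg[OF p(1) that] h0[OF that] mono[OF that, of 0 n] by simp
  then have "(\<Sum>y\<in>Y. p y * h n y) = 0"
    using le by (intro antisym sum_nonneg)
  then have zero: "p y * h n y = 0" if "y \<in> Y" for y
    using sum_nonneg_eq_0_iff[OF finite_states, of "\<lambda>y. p y * h n y"] nonneg that by blast
  have "p y = 0" if "y \<in> Y - residual_part Y S" for y
    using zero[of y] n[OF that] that by auto
  then show ?thesis using p(1) by blast
qed

lemma residual_part_credal_nonempty:
  assumes "x \<in> residual_part Y S"
  shows "restricted_credal_set Y S (residual_part Y S) x \<noteq> {}"
  using residual_part_credal[OF assms] unfolding restricted_credal_set_def by blast

text \<open>If every state of \<open>A\<close> admits a mass function living on \<open>A\<close>, an adversary can keep the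
  process inside \<open>A\<close> forever, away from the maximal classes.\<close>

lemma closable_subset_residual:
  assumes A: "A \<subseteq> Y" "A \<inter> maximal_part Y S = {}"
    and p: "\<And>x. x \<in> A \<Longrightarrow> \<exists>p\<in>credal_set Y S x. \<forall>y\<in>Y - A. p y = 0"
  shows "A \<subseteq> residual_part Y S"
proof
  fix x assume x: "x \<in> A"
  let ?h = "\<lambda>n. (lower_conjugate Y S ^^ n) (ind Y (maximal_part Y S))"
  have "?h n x \<le> 0" for n
    using x
  proof (induction n arbitrary: x)
    case 0
    then have "x \<in> Y" "x \<notin> maximal_part Y S" using A by blast+
    then show ?case by (simp add: ind_def)
  next
    case (Suc n)
    obtain p where p: "p \<in> credal_set Y S x" "\<forall>y\<in>Y - A. p y = 0"
      using p[OF Suc.prems] by blast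
    have "?h (Suc n) x \<le> (\<Sum>y\<in>Y. p y * ?h n y)"
      using lower_conjugate_le_expectation[OF _ p(1)] A Suc.prems by auto
    also have "\<dots> \<le> 0"
    proof (rule sum_nonpos)
      fix y assume y: "y \<in> Y"
      show "p y * ?h n y \<le> 0"
        using y Suc.IH[of y] p(2) credal_nonneg[OF p(1) y]
        by (cases "y \<in> A") (auto simp: mult_nonneg_nonpos)
    qed
    finally show ?case .
  qed
  then show "x \<in> residual_part Y S"
    using x A unfolding residual_part_def lower_reachable_def by (auto simp: not_less)
qed

end

section \<open>Upper and lower limits of the iterates\<close>

text \<open>The upper limit as a real number, given by its eventual bound and its frequent approach.
  A lower limit L is expressed through the negated sequence and \<open>- L\<close>.\<close>

definition is_limsup :: "(nat \<Rightarrow> real) \<Rightarrow> real \<Rightarrow> bool" where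
  "is_limsup v a \<longleftrightarrow> (\<forall>\<delta>>0. (\<forall>\<^sub>F n in sequentially. v n < a + \<delta>) \<and>
                            (\<exists>\<^sub>F n in sequentially. v n > a - \<delta>))"

text \<open>The upper limit is the infimum of all eventual upper bounds; boundedness makes this set
  non-empty and bounded below.\<close>

lemma bounded_is_limsup:
  assumes "\<And>n. \<bar>v n\<bar> \<le> B"
  shows "\<exists>a. is_limsup v a"
proof -
  define E where "E = {b. \<forall>\<^sub>F n in sequentially. v n \<le> b}"
  have vB: "v n \<le> B" "- B \<le> v n" for n
    using assms[of n] by auto
  have "B \<in> E" unfolding E_def using vB by simp
  have lb: "- B \<le> b" if "b \<in> E" for b
  proof -
    have "\<forall>\<^sub>F n in sequentially. v n \<le> b" using that by (simp add: E_def)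
    then obtain n where "v n \<le> b" by (auto simp: eventually_sequentially)
    then show ?thesis using vB(2)[of n] by simp
  qed
  then have bdd: "bdd_below E" unfolding bdd_below_def by blast
  have "\<forall>\<^sub>F n in sequentially. v n < Inf E + \<delta>" if "\<delta> > 0" for \<delta>
  proof -
    obtain b where "b \<in> E" "b < Inf E + \<delta>"
      using cInf_lessD[of E "Inf E + \<delta>"] \<open>B \<in> E\<close> \<open>\<delta> > 0\<close> by auto
    then show ?thesis unfolding E_def by (auto elim: eventually_mono)
  qed
  moreover have "\<exists>\<^sub>F n in sequentially. v n > Inf E - \<delta>" if "\<delta> > 0" for \<delta>
  proof (rule ccontr)
    assume "\<not> ?thesis"
    then have "Inf E - \<delta> \<in> E" by (simp add: E_def not_frequently not_less)
    then show False using cInf_lower[OF _ bdd, of "Inf E - \<delta>"] \<open>\<delta> > 0\<close> by simp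
  qed
  ultimately show ?thesis unfolding is_limsup_def by blast
qed

context upper_operator
begin

lemma up_power_Suc: "f \<in> fun_space Y \<Longrightarrow> (S ^^ Suc n) f = up ((S ^^ n) f)"
  using up_eq[OF power_fun_space] by simp

lemma power_bounded:
  assumes "f \<in> fun_space Y" "x \<in> Y"
  shows "\<bar>(S ^^ n) f x\<bar> \<le> (\<Sum>y\<in>Y. \<bar>f y\<bar>)"
proof -
  interpret P: upper_operator Y "S ^^ n" by (rule upper_operator_power)
  have "\<bar>f y\<bar> \<le> (\<Sum>y\<in>Y. \<bar>f y\<bar>)" if "y \<in> Y" for y
    using that finite_states by (intro member_le_sum) auto
  then have "f y \<le> (\<Sum>y\<in>Y. \<bar>f y\<bar>)" "- (\<Sum>y\<in>Y. \<bar>f y\<bar>) \<le> f y" if "y \<in> Y" for y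
    using that by (force simp: abs_le_iff)+
  then have "P.up f x \<le> (\<Sum>y\<in>Y. \<bar>f y\<bar>)" "- (\<Sum>y\<in>Y. \<bar>f y\<bar>) \<le> P.up f x"
    using P.up_le_const[OF assms(2), of f] P.up_ge_const[OF assms(2), of _ f] by blast+
  then show ?thesis using P.up_eq[OF assms(1)] by (simp add: abs_le_iff)
qed

text \<open>Since \<open>Y\<close> is finite, all late iterates lie below U + \<delta>
  simultaneously. Applying the operator to one of them, just before a time when the value at x is
  near U x, gives the claim; each of the two approximations costs half of e.\<close>

lemma limsup_le_up:
  assumes f: "f \<in> fun_space Y" and x: "x \<in> Y"
    and U: "\<And>y. y \<in> Y \<Longrightarrow> is_limsup (\<lambda>n. (S ^^ n) f y) (U y)"
  shows "U x \<le> up U x"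
proof (rule field_le_epsilon)
  fix e :: real assume "e > 0"
  define \<delta> where "\<delta> = e / 2"
  have "\<delta> > 0" using \<open>e > 0\<close> by (simp add: \<delta>_def)
  then have "\<forall>\<^sub>F n in sequentially. \<forall>y\<in>Y. (S ^^ n) f y < U y + \<delta>"
    using U finite_states by (intro eventually_ball_finite) (auto simp: is_limsup_def)
  then obtain N where N: "\<And>n y. n \<ge> N \<Longrightarrow> y \<in> Y \<Longrightarrow> (S ^^ n) f y < U y + \<delta>"
    by (auto simp: eventually_sequentially)
  have "\<exists>\<^sub>F n in sequentially. (S ^^ n) f x > U x - \<delta>"
    using U[OF x] \<open>\<delta> > 0\<close> by (auto simp: is_limsup_def)
  \<comment> \<open>\<open>Suc N\<close> ensures that the preceding time m is still at least
    N.\<close>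
  then obtain n where "n \<ge> Suc N" "(S ^^ n) f x > U x - \<delta>"
    unfolding frequently_sequentially by blast
  moreover from this obtain m where m: "n = Suc m" "m \<ge> N"
    by (cases n) auto
  moreover have "up ((S ^^ m) f) x \<le> up U x + \<delta>"
    using N[OF m(2)] x by (intro up_le_up_plus) (auto intro: less_imp_le)
  ultimately show "U x \<le> up U x + e"
    using up_power_Suc[OF f, of m] by (simp add: \<delta>_def field_simps)
qed

text \<open>The mirror argument: late iterates lie above L - \<delta>, and the value at x is
  frequently near L x.\<close>

lemma up_le_liminf:
  assumes f: "f \<in> fun_space Y" and x: "x \<in> Y"
    and L: "\<And>y. y \<in> Y \<Longrightarrow> is_limsup (\<lambda>n. - (S ^^ n) f y) (- L y)"
  shows "up L x \<le> L x"
proof (rule field_le_epsilon)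
  fix e :: real assume "e > 0"
  define \<delta> where "\<delta> = e / 2"
  have "\<delta> > 0" using \<open>e > 0\<close> by (simp add: \<delta>_def)
  then have "\<forall>\<^sub>F n in sequentially. \<forall>y\<in>Y. - (S ^^ n) f y < - L y + \<delta>"
    using L finite_states by (intro eventually_ball_finite) (auto simp: is_limsup_def)
  then obtain N where N: "\<And>n y. n \<ge> N \<Longrightarrow> y \<in> Y \<Longrightarrow> - (S ^^ n) f y < - L y + \<delta>"
    by (auto simp: eventually_sequentially)
  have "\<exists>\<^sub>F n in sequentially. - (S ^^ n) f x > - L x - \<delta>"
    using L[OF x] \<open>\<delta> > 0\<close> by (auto simp: is_limsup_def)
  then obtain n where "n \<ge> Suc N" "- (S ^^ n) f x > - L x - \<delta>"
    unfolding frequently_sequentially by blast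
  moreover from this obtain m where m: "n = Suc m" "m \<ge> N"
    by (cases n) auto
  moreover have "up L x \<le> up ((S ^^ m) f) x + \<delta>"
    using N[OF m(2)] x by (intro up_le_up_plus) (auto simp: algebra_simps intro: less_imp_le)
  ultimately show "up L x \<le> L x + e"
    using up_power_Suc[OF f, of m] by (simp add: \<delta>_def field_simps)
qed

end

text \<open>Let c be the least lower limit on \<open>C\<close>, attained at x. If U y > L y, then at
  some late time the value at y is near U y while all values on \<open>C\<close> are almost c. The
  contraction then lifts all sufficiently later values at x above c by a fixed amount, contradicting
  the choice of x.\<close>

lemma regular_class_limsup_le_liminf:
  assumes T: "upper_operator X T" and S: "upper_operator Y S" and YX: "Y \<subseteq> X"
    and le: "\<And>g x. x \<in> Y \<Longrightarrow> S (restrict g Y) x \<le> T (restrict g X) x"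
    and C: "C \<in> maximal_classes Y S" and reg: "regular_class Y S C" and y: "y \<in> C"
    and f: "f \<in> fun_space X"
    and U: "\<And>x. x \<in> X \<Longrightarrow> is_limsup (\<lambda>n. (T ^^ n) f x) (U x)"
    and L: "\<And>x. x \<in> X \<Longrightarrow> is_limsup (\<lambda>n. - (T ^^ n) f x) (- L x)"
  shows "U y \<le> L y"
proof (rule ccontr)
  assume neg: "\<not> U y \<le> L y"
  interpret T: upper_operator X T by fact
  interpret S: upper_operator Y S by fact
  have CY: "C \<subseteq> Y" using S.maximal_class_subset[OF C] .
  then have CX: "C \<subseteq> X" using YX by blast
  have "finite C" using CY S.finite_states finite_subset by blast
  \<comment> \<open>Domination in one step and monotonicity carry lower bounds for \<open>S\<close>,
    started from an iterate of \<open>T\<close>, over to \<open>T\<close>.\<close>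
  have iterate: "(S ^^ k) (restrict ((T ^^ n) f) Y) x \<le> (T ^^ (n + k)) f x" if "x \<in> Y" for k n x
    using that
  proof (induction k arbitrary: x)
    case 0
    then show ?case by simp
  next
    case (Suc k)
    let ?g = "(S ^^ k) (restrict ((T ^^ n) f) Y)"
    have "(S ^^ Suc k) (restrict ((T ^^ n) f) Y) x = S.up ?g x"
      by (subst S.up_power_Suc) auto
    also have "\<dots> \<le> S.up ((T ^^ (n + k)) f) x"
      using Suc by (intro S.up_mono)
    also have "\<dots> \<le> T.up ((T ^^ (n + k)) f) x"
      unfolding S.up_def T.up_def by (rule le[OF Suc.prems])
    also have "\<dots> = (T ^^ (n + Suc k)) f x"
      using T.up_power_Suc[OF f, of "n + k"] by simp
    finally show ?case .
  qed
  obtain N \<epsilon> where \<epsilon>: "\<epsilon> > 0" and contr: "\<And>g m n x y. x \<in> C \<Longrightarrow> y \<in> C \<Longrightarrow> n \<ge> N \<Longrightarrow>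
      (\<forall>z\<in>C. m \<le> g z) \<Longrightarrow> m + \<epsilon> * (g y - m) \<le> (S ^^ n) (restrict g Y) x"
    using S.regular_class_contraction[OF C reg] by blast
  define c where "c = Min (L ` C)"
  have "c \<in> L ` C" unfolding c_def using \<open>finite C\<close> y by (intro Min_in) auto
  then obtain x where x: "x \<in> C" "L x = c" by blast
  have c_le: "c \<le> L z" if "z \<in> C" for z
    unfolding c_def using \<open>finite C\<close> that by (intro Min_le) auto
  \<comment> \<open>The gain \<epsilon> (U y - c) must absorb two errors of size \<delta>, one below
    c at time n and one above c at time k.\<close>
  define \<delta> where "\<delta> = \<epsilon> * (U y - c) / 2"
  have "\<delta> > 0" using neg c_le[OF y] \<epsilon> by (simp add: \<delta>_def)
  then have "\<forall>\<^sub>F n in sequentially. \<forall>z\<in>C. - (T ^^ n) f z < - L z + \<delta>"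
    using L CX \<open>finite C\<close> by (intro eventually_ball_finite) (auto simp: is_limsup_def)
  then obtain n0 where n0: "\<And>n z. n \<ge> n0 \<Longrightarrow> z \<in> C \<Longrightarrow> - (T ^^ n) f z < - L z + \<delta>"
    by (auto simp: eventually_sequentially)
  have "\<exists>\<^sub>F n in sequentially. (T ^^ n) f y > U y - \<delta>"
    using U y CX \<open>\<delta> > 0\<close> by (auto simp: is_limsup_def)
  then obtain n where n: "n \<ge> n0" "(T ^^ n) f y > U y - \<delta>"
    unfolding frequently_sequentially by blast
  have "\<exists>\<^sub>F k in sequentially. - (T ^^ k) f x > - L x - \<delta>"
    using L x CX \<open>\<delta> > 0\<close> unfolding is_limsup_def by blast
  \<comment> \<open>This leaves at least N steps between the times n and k, as the contraction
    requires.\<close>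
  then obtain k where k: "k \<ge> n + N" "- (T ^^ k) f x > - L x - \<delta>"
    unfolding frequently_sequentially by blast
  have "\<forall>z\<in>C. c - \<delta> \<le> (T ^^ n) f z"
    using n0[OF n(1)] c_le by fastforce
  then have "(c - \<delta>) + \<epsilon> * ((T ^^ n) f y - (c - \<delta>)) \<le> (S ^^ (k - n)) (restrict ((T ^^ n) f) Y) x"
    using k x y by (intro contr) auto
  also have "\<dots> \<le> (T ^^ k) f x"
    using iterate[of x "k - n" n] x CY k by auto
  also have "\<dots> < c + \<delta>" using k x by simp
  finally have "\<epsilon> * ((T ^^ n) f y - (c - \<delta>)) < 2 * \<delta>" by simp
  moreover have "\<epsilon> * (U y - c) \<le> \<epsilon> * ((T ^^ n) f y - (c - \<delta>))"
    using n \<epsilon> by (intro mult_left_mono) auto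
  ultimately show False by (simp add: \<delta>_def)
qed

section \<open>Convergence\<close>

lemma residual_states_0: "residual_states X T 0 = X"
  and residual_operator_0: "residual_operator X T 0 = T"
  by (simp_all add: residual_states_def residual_operator_def)

lemma residual_states_Suc:
  "residual_states X T (Suc l) = residual_part (residual_states X T l) (residual_operator X T l)"
  and residual_operator_Suc:
  "residual_operator X T (Suc l) =
     restricted_operator (residual_states X T l) (residual_operator X T l) (residual_states X T (Suc l))"
  by (simp_all add: residual_states_def residual_operator_def Let_def split: prod.splits)

text \<open>The invariant of the decomposition. Domination by \<open>T\<close> serves the comparison
  of iterates on regular classes; the inheritance of mass functions keeps those living on a fixed
  subset available at every stage.\<close>

lemma residual_stage:
  fixes X :: "'a set"
  assumes "upper_operator X T"
  shows "upper_operator (residual_states X T l) (residual_operator X T l) \<and>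
    residual_states X T l \<subseteq> X \<and>
    (\<forall>g. \<forall>x\<in>residual_states X T l.
       residual_operator X T l (restrict g (residual_states X T l)) x \<le> T (restrict g X) x) \<and>
    (\<forall>x\<in>residual_states X T l. \<forall>p\<in>credal_set X T x.
       (\<forall>y\<in>X - residual_states X T l. p y = 0) \<longrightarrow>
       restrict p (residual_states X T l) \<in> credal_set (residual_states X T l) (residual_operator X T l) x)"
proof (induction l)
  case 0
  have "restrict p X = p" if "p \<in> credal_set X T x" for p x
    using that unfolding credal_set_def mass_functions_def by (auto simp: PiE_restrict)
  then show ?case using assms by (auto simp: residual_states_0 residual_operator_0)
next
  case (Suc l)
  define Y S Z where "Y = residual_states X T l" and "S = residual_operator X T l"
    and "Z = residual_part Y S"
  have Z: "residual_states X T (Suc l) = Z"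
    and R: "residual_operator X T (Suc l) = restricted_operator Y S Z"
    by (simp_all add: residual_states_Suc residual_operator_Suc Y_def S_def Z_def)
  interpret S: upper_operator Y S using Suc unfolding Y_def S_def by blast
  have YX: "Y \<subseteq> X"
    and le: "\<And>g x. x \<in> Y \<Longrightarrow> S (restrict g Y) x \<le> T (restrict g X) x"
    and credal: "\<And>x p. x \<in> Y \<Longrightarrow> p \<in> credal_set X T x \<Longrightarrow> \<forall>y\<in>X - Y. p y = 0 \<Longrightarrow>
      restrict p Y \<in> credal_set Y S x"
    using Suc unfolding Y_def S_def by blast+
  have ZY: "Z \<subseteq> Y" unfolding Z_def by (rule S.residual_part_subset)
  have ne: "restricted_credal_set Y S Z x \<noteq> {}" if "x \<in> Z" for x
    using S.residual_part_credal_nonempty that unfolding Z_def .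
  have "restricted_operator Y S Z (restrict g Z) x \<le> T (restrict g X) x" if "x \<in> Z" for g x
    using S.restricted_le_up[OF ZY ne that, of g] le[of x g] that ZY unfolding S.up_def by fastforce
  moreover have "restrict p Z \<in> credal_set Z (restricted_operator Y S Z) x"
    if x: "x \<in> Z" and p: "p \<in> credal_set X T x" "\<forall>y\<in>X - Z. p y = 0" for x p
  proof -
    \<comment> \<open>Vanishing outside \<open>Z\<close> entails vanishing outside \<open>Y\<close>,
      so p descends first to \<open>Y\<close> and then to \<open>Z\<close>.\<close>
    have "restrict p Y \<in> credal_set Y S x"
      using x p ZY by (intro credal) auto
    moreover have "\<forall>y\<in>Y - Z. restrict p Y y = 0"
      using p(2) YX by auto
    ultimately have "restrict (restrict p Y) Z \<in> credal_set Z (restricted_operator Y S Z) x"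
      by (intro S.restricted_credal[OF ZY _ x] ne)
    moreover have "restrict (restrict p Y) Z = restrict p Z"
      using ZY by (simp add: Int_absorb1)
    ultimately show ?thesis by simp
  qed
  moreover have "upper_operator Z (restricted_operator Y S Z)"
    by (rule S.restricted_upper_operator[OF ZY ne])
  ultimately show ?case unfolding Z R using ZY YX by blast
qed

lemma residual_states_depth:
  assumes "finite X"
  shows "residual_states X T (decomposition_depth X T) = {}"
  unfolding decomposition_depth_def
  using LeastI_ex[of "\<lambda>l. l \<ge> 1 \<and> residual_states X T l = {}"] ex_decomposition_depth[OF assms]
  by blast

theorem theorem20:
  fixes X :: "'a set" and T :: "('a \<Rightarrow> real) \<Rightarrow> ('a \<Rightarrow> real)"
  assumes "finite X" and "X \<noteq> {}"
    and "upper_transition_operator X T"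
    and "\<forall>l\<in>{1..decomposition_depth X T}.
           \<forall>C\<in>maximal_classes (residual_states X T (l - 1)) (residual_operator X T (l - 1)).
             regular_class (residual_states X T (l - 1)) (residual_operator X T (l - 1)) C"
  shows "convergent_operator X T"
proof -
  have T: "upper_operator X T" using assms by unfold_locales
  interpret T: upper_operator X T by (rule T)
  have "convergent (\<lambda>n. (T ^^ n) f x)" if f: "f \<in> fun_space X" and "x \<in> X" for f x
  proof -
    have "\<exists>a. is_limsup (\<lambda>n. (T ^^ n) f x) a" if "x \<in> X" for x
      using bounded_is_limsup T.power_bounded[OF f that] .
    then obtain U where U: "\<And>x. x \<in> X \<Longrightarrow> is_limsup (\<lambda>n. (T ^^ n) f x) (U x)"
      by metis
    have "\<exists>a. is_limsup (\<lambda>n. - (T ^^ n) f x) (- a)" if xX: "x \<in> X" for x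
    proof -
      obtain a where "is_limsup (\<lambda>n. - (T ^^ n) f x) a"
        using bounded_is_limsup[of "\<lambda>n. - (T ^^ n) f x"] T.power_bounded[OF f xX] by auto
      then show ?thesis by (intro exI[of _ "- a"]) simp
    qed
    then obtain L where L: "\<And>x. x \<in> X \<Longrightarrow> is_limsup (\<lambda>n. - (T ^^ n) f x) (- L x)"
      by metis
    define w where "w x = U x - L x" for x
    define D where "D = Max (w ` X)"
    define A where "A = {x \<in> X. w x = D}"
    have w_le: "w x \<le> D" if "x \<in> X" for x
      unfolding D_def using assms(1) that by (intro Max_ge) auto
    have "D \<in> w ` X" unfolding D_def using assms by (intro Max_in) auto
    then have "A \<noteq> {}" by (auto simp: A_def)
    have closable: "\<exists>p\<in>credal_set X T x. \<forall>y\<in>X - A. p y = 0" if "x \<in> A" for x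
    proof -
      have x: "x \<in> X" "w x = D" using that by (auto simp: A_def)
      have "U x \<le> T.up U x" using T.limsup_le_up[OF f x(1) U] .
      also have "T.up U x = T.up (\<lambda>y. L y + w y) x" by (simp add: w_def)
      also have "\<dots> \<le> T.up L x + T.up w x" by (rule T.up_add[OF x(1)])
      also have "T.up L x \<le> L x" using T.up_le_liminf[OF f x(1) L] .
      finally have "D \<le> T.up w x" using x(2) w_def[of x] by simp
      then obtain p where p: "p \<in> credal_set X T x" "D \<le> (\<Sum>y\<in>X. p y * w y)"
        using T.credal_attains[OF x(1), of w] by auto
      \<comment> \<open>The nonnegative function D - w vanishes in \<open>X\<close> exactly on
        \<open>A\<close>; as its expectation under p is zero, p has no mass outside
        \<open>A\<close>.\<close>
      have nonneg: "p y * (D - w y) \<ge> 0" if "y \<in> X" for y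
        using T.credal_nonneg[OF p(1) that] w_le[OF that] by simp
      have "(\<Sum>y\<in>X. p y * (D - w y)) = D - (\<Sum>y\<in>X. p y * w y)"
        using T.credal_sum[OF p(1)]
        by (simp add: right_diff_distrib sum_subtractf flip: sum_distrib_right)
      then have "(\<Sum>y\<in>X. p y * (D - w y)) = 0"
        using p(2) sum_nonneg[of X "\<lambda>y. p y * (D - w y)"] nonneg by fastforce
      then have "p y * (D - w y) = 0" if "y \<in> X" for y
        using sum_nonneg_eq_0_iff[OF assms(1), of "\<lambda>y. p y * (D - w y)"] nonneg that by blast
      then show ?thesis using p(1) by (intro bexI[of _ p]) (auto simp: A_def)
    qed
    have "D \<le> 0"
    proof (rule ccontr)
      assume "\<not> D \<le> 0"
      have "A \<subseteq> residual_states X T l" if "l \<le> decomposition_depth X T" for l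
        using that
      proof (induction l)
        case 0
        then show ?case by (auto simp: A_def residual_states_0)
      next
        case (Suc l)
        define Y S where "Y = residual_states X T l" and "S = residual_operator X T l"
        have AY: "A \<subseteq> Y" using Suc by (simp add: Y_def)
        have S: "upper_operator Y S" and YX: "Y \<subseteq> X"
          and le: "\<And>g x. x \<in> Y \<Longrightarrow> S (restrict g Y) x \<le> T (restrict g X) x"
          and credal: "\<And>x p. x \<in> Y \<Longrightarrow> p \<in> credal_set X T x \<Longrightarrow> \<forall>y\<in>X - Y. p y = 0 \<Longrightarrow>
            restrict p Y \<in> credal_set Y S x"
          using residual_stage[OF T, of l] unfolding Y_def S_def by blast+
        \<comment> \<open>Stage l of the recursion corresponds to index \<open>Suc l\<close> of the
          hypothesis, whose indices start at 1.\<close>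
        have reg: "regular_class Y S C" if "C \<in> maximal_classes Y S" for C
          using assms(4)[rule_format, of "Suc l" C] Suc.prems that by (simp add: Y_def S_def)
        have "U y \<le> L y" if "y \<in> maximal_part Y S" for y
          using that regular_class_limsup_le_liminf[OF T S YX le _ reg _ f U L]
          unfolding maximal_part_def by blast
        \<comment> \<open>On \<open>A\<close> the gap w equals D > 0, whereas on the maximal classes
          it is nonpositive.\<close>
        then have "A \<inter> maximal_part Y S = {}"
          using \<open>\<not> D \<le> 0\<close> by (fastforce simp: A_def w_def)
        moreover have "\<exists>p\<in>credal_set Y S x. \<forall>y\<in>Y - A. p y = 0" if x: "x \<in> A" for x
        proof -
          obtain p where p: "p \<in> credal_set X T x" "\<forall>y\<in>X - A. p y = 0"
            using closable[OF x] by blast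
          have "restrict p Y \<in> credal_set Y S x"
            using p x AY by (intro credal) auto
          moreover have "\<forall>y\<in>Y - A. restrict p Y y = 0"
            using p(2) YX by auto
          ultimately show ?thesis by blast
        qed
        ultimately show ?case
          using upper_operator.closable_subset_residual[OF S AY]
          by (simp add: residual_states_Suc Y_def S_def)
      qed
      from this[of "decomposition_depth X T"] show False
        using residual_states_depth[OF assms(1), of T] \<open>A \<noteq> {}\<close> by simp
    qed
    then have UL: "U x \<le> L x" using w_le[OF \<open>x \<in> X\<close>] by (simp add: w_def)
    \<comment> \<open>The lower limit gives the eventual lower bounds and the upper limit, now at
      most L x, the eventual upper bounds.\<close>
    have "(\<lambda>n. (T ^^ n) f x) \<longlonglongrightarrow> L x"
    proof (rule order_tendstoI)
      fix a assume "a < L x"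
      then show "\<forall>\<^sub>F n in sequentially. a < (T ^^ n) f x"
        using L[OF \<open>x \<in> X\<close>] unfolding is_limsup_def
        by (auto dest!: spec[of _ "L x - a"] elim: eventually_mono)
    next
      fix a assume "L x < a"
      then show "\<forall>\<^sub>F n in sequentially. (T ^^ n) f x < a"
        using U[OF \<open>x \<in> X\<close>] UL unfolding is_limsup_def
        by (auto dest!: spec[of _ "a - U x"] elim: eventually_mono)
    qed
    then show ?thesis by (rule convergentI)
  qed
  then show ?thesis unfolding convergent_operator_def by blast
qed

end
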